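(* Let $G$ be a connected graph on $n\geq 3$ vertices with $q(G)=2$. Then \[ |E(G)|\geq\begin{cases}2n-4, & \text{if $n$ is even},\\ 2n-3, & \text{if $n$ is odd}.\end{cases} \] Moreover, for $n$ even, equality $|E(G)|=2n-4$ holds if and only if $G$ is isomorphic to the cube graph $Q_3$ or to a double-ended candle $G_k$ (with $n=2k$); for $n$ odd, equality $|E(G)|=2n-3$ holds if and only if $G$ is isomorphic to a single-ended candle $G'_k$ (with $n=2k+1$).
   Context: All graphs are simple, finite and undirected. For a graph $G$ on $n$ vertices, $\mathcal{S}(G)$ is the set of real symmetric $n\times n$ matrices $A=[a_{ij}]$ such that for $i\neq j$, $a_{ij}\neq 0$ if and only if $\{i,j\}\in E(G)$ (diagonal entries are unrestricted). $q(G)=\min\{q(A): A\in\mathcal{S}(G)\}$, where $q(A)$ is the number of distinct eigenvalues of $A$. $Q_3$ is the 8-vertex graph of the 3-dimensional cube. Double-ended candle: for $k\geq 2$, $G_k$ is the graph on vertex set $\{1,2,\dots,2k\}$ partitioned into levels $L_0=\{1\}$, $L_i=\{2i,2i+1\}$ for $1\leq i\leq k-1$, and $L_k=\{2k\}$, where two vertices are adjacent if and only if they lie in consecutive levels $L_{i-1},L_i$ (every such pair is adjacent). (So $G_2=C_4$; for $k\ge3$, $G_k$ is obtained from the path $1,2,4,\dots,2k-2,2k$ by adding, for each $i=1,\dots,k-1$, a vertex $2i+1$ with the same neighbors as $2i$ and not adjacent to $2i$.) It has $2k$ vertices and $4k-4$ edges; its ends are the vertices $1$ and $2k$. Single-ended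 candle: for $k\geq 1$, $G'_k$ is the graph on vertex set $\{1,\dots,2k+1\}$ with levels $L_0=\{1\}$, $L_i=\{2i,2i+1\}$ for $1\leq i\leq k$, in which two vertices in consecutive levels are always adjacent, the two vertices $2k,2k+1$ of the last level are adjacent, and there are no other edges. (So $G'_1=K_3$, and for $k\ge 2$, $G'_k$ is obtained from $G_k$ by adding a vertex adjacent to $2k$ and to all neighbors of $2k$.) It has $2k+1$ vertices and $4k-1$ edges; its ends are vertex $1$ and the adjacent pair $\{2k,2k+1\}$. *)

theory Defs
  imports "Jordan_Normal_Form.Char_Poly"
begin

text \<open>Simple graphs: a finite vertex set V and a set E of 2-element subsets of V.\<close>
definition simple_graph :: "nat set \<Rightarrow> nat set set \<Rightarrow> bool" where
  "simple_graph V E \<longleftrightarrow> finite V \<and> E \<subseteq> {{u, v} | u v. u \<in> V \<and> v \<in> V \<and> u \<noteq> v}"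

definition graph_connected :: "nat set \<Rightarrow> nat set set \<Rightarrow> bool" where
  "graph_connected V E \<longleftrightarrow>
     (\<forall>u\<in>V. \<forall>v\<in>V. (u, v) \<in> {(a, b). {a, b} \<in> E}\<^sup>*)"

definition graph_iso :: "nat set \<Rightarrow> nat set set \<Rightarrow> nat set \<Rightarrow> nat set set \<Rightarrow> bool" where
  "graph_iso V1 E1 V2 E2 \<longleftrightarrow>
     (\<exists>f. bij_betw f V1 V2 \<and> (\<forall>u\<in>V1. \<forall>v\<in>V1. {u, v} \<in> E1 \<longleftrightarrow> {f u, f v} \<in> E2))"

text \<open>S(G) for a graph on vertex set {0..<n}.\<close>
definition S_graph :: "nat \<Rightarrow> nat set set \<Rightarrow> real mat set" where
  "S_graph n E = {A. A \<in> carrier_mat n n \<and> A\<^sup>T = A \<and>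
      (\<forall>i<n. \<forall>j<n. i \<noteq> j \<longrightarrow> (A $$ (i, j) \<noteq> 0 \<longleftrightarrow> {i, j} \<in> E))}"

text \<open>Number of distinct eigenvalues of a (real) matrix.\<close>
definition q_mat :: "real mat \<Rightarrow> nat" where
  "q_mat A = card {k. eigenvalue A k}"

definition q_graph :: "nat \<Rightarrow> nat set set \<Rightarrow> nat" where
  "q_graph n E = (LEAST m. \<exists>A \<in> S_graph n E. q_mat A = m)"

text \<open>The cube Q3 on vertices 0..7: adjacent iff the 3-bit codes differ in exactly one bit.\<close>
definition Q3_V :: "nat set" where "Q3_V = {0..<8}"
definition Q3_E :: "nat set set" where
  "Q3_E = {{u, v} | u v. u < 8 \<and> v < 8 \<and>
      card {b. b < 3 \<and> odd (u div 2 ^ b) \<noteq> odd (v div 2 ^ b)} = 1}"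

text \<open>Double-ended candle G_k: vertices 1..2k, level of v is v div 2.\<close>
definition candle_V :: "nat \<Rightarrow> nat set" where "candle_V k = {1..2*k}"
definition candle_E :: "nat \<Rightarrow> nat set set" where
  "candle_E k = {{u, v} | u v. u \<in> {1..2*k} \<and> v \<in> {1..2*k} \<and> v div 2 = u div 2 + 1}"

text \<open>Single-ended candle G'_k: vertices 1..2k+1, level of v is v div 2, plus edge {2k,2k+1}.\<close>
definition candle1_V :: "nat \<Rightarrow> nat set" where "candle1_V k = {1..2*k+1}"
definition candle1_E :: "nat \<Rightarrow> nat set set" where
  "candle1_E k = {{u, v} | u v. u \<in> {1..2*k+1} \<and> v \<in> {1..2*k+1} \<and> v div 2 = u div 2 + 1}
                 \<union> {{2*k, 2*k+1}}"

end

theory Submission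
  imports Defs "Jordan_Normal_Form.Schur_Decomposition"
begin

text \<open>
  A symmetric matrix with two eigenvalues is, up to an affine change, a symmetric orthogonal
  matrix \<open>M\<close>, so two non-adjacent vertices never have exactly one common neighbour. Arrange the
  vertices by their distance from a vertex \<open>v\<close> of minimal degree \<open>d\<close>: every vertex at distance at
  least two then has at least two neighbours one level closer to \<open>v\<close>, and counting edges by their
  endpoint farther from \<open>v\<close> gives \<open>2n - 2 - d + s + t\<close> edges, where \<open>s\<close> counts the edges inside a level
  and \<open>t\<close> the superfluous downward edges. If \<open>d \<ge> 4\<close> there are at least \<open>2n\<close> edges. If \<open>d = 2\<close> and
  \<open>s + t\<close> is minimal, all levels have at most two vertices and the graph is a candle; if \<open>d = 3\<close>
  and there are at most \<open>2n - 4\<close> (\<open>n\<close> even) or \<open>2n - 3\<close> (\<open>n\<close> odd) edges, the levels are forced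
  to be those of the cube. For odd \<open>n\<close> the graph is not bipartite, by comparing row norms of \<open>M\<close>
  on the two sides, so \<open>s \<ge> 1\<close>.
\<close>

text \<open>The common-neighbour rule alone does not give the theorem. In K_{2,3} and K_{2,4} no two
  non-adjacent vertices have exactly one common neighbour, yet K_{2,3} has 2n - 4 edges with n odd,
  and K_{2,4} has 2n - 4 edges without being a candle or the cube. Beyond that rule the entries of
  \<open>m\<close> are therefore used twice: in \<open>bipartite_even\<close>, which excludes
  K_{2,3}, and in \<open>common_neighbour_outside_pair\<close>, which excludes K_{2,4} because a
  plane contains no three pairwise orthogonal nonzero vectors. The root has minimal degree so that
  its degree bounds all others from below. For d = 3 this drives the argument: a vertex with nothing
  above it and only two neighbours below it still needs a third neighbour, so the far end of the
  graph always spends some of s + t.\<close>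

section \<open>From two eigenvalues to a symmetric orthogonal matrix\<close>

text \<open>\<open>q_mat\<close> counts real eigenvalues, while the triangular form used below
  exists over the complex numbers. The Hermitian form of \<open>A\<close> at \<open>z\<close> is
  \<open>e\<close> times the squared norm of \<open>z\<close> and, by symmetry, its own conjugate;
  so no eigenvalue is missed by the real count.\<close>

lemma symmetric_complex_eigenvalue_real:
  fixes A :: "real mat"
  assumes A: "A \<in> carrier_mat n n" and sym: "A\<^sup>T = A"
    and ev: "eigenvalue (map_mat complex_of_real A) e"
  shows "e = complex_of_real (Re e)" and "eigenvalue A (Re e)"
proof -
  let ?c = "map_mat complex_of_real A"
  have c: "?c \<in> carrier_mat n n" using A by simp
  obtain z where z: "z \<in> carrier_vec n" "z \<noteq> 0\<^sub>v n" "?c *\<^sub>v z = e \<cdot>\<^sub>v z"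
    using ev A unfolding eigenvalue_def eigenvector_def by auto
  have a_sym: "A $$ (i,j) = A $$ (j,i)" if "i < n" "j < n" for i j
    using sym A that by (metis carrier_matD index_transpose_mat(1))
  have row: "(\<Sum>j<n. complex_of_real (A $$ (i,j)) * z $ j) = e * z $ i" if "i < n" for i
    using arg_cong[OF z(3), of "\<lambda>w. w $ i"] that A z(1)
    by (simp add: scalar_prod_def atLeast0LessThan)
  define N where "N = (\<Sum>i<n. (cmod (z $ i))\<^sup>2)"
  have N: "complex_of_real N = (\<Sum>i<n. cnj (z $ i) * z $ i)"
    unfolding N_def of_real_sum
    by (intro sum.cong refl) (simp only: complex_norm_square mult.commute)
  have "N \<noteq> 0"
  proof
    assume "N = 0"
    then have "\<forall>i<n. z $ i = 0"
      unfolding N_def by (subst (asm) sum_nonneg_eq_0_iff) auto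
    then have "z = 0\<^sub>v n" using z(1) by (intro eq_vecI) auto
    with z(2) show False by simp
  qed
  have L: "e * N = (\<Sum>i<n. \<Sum>j<n. cnj (z $ i) * (complex_of_real (A $$ (i,j)) * z $ j))"
    unfolding N sum_distrib_left
    by (intro sum.cong refl) (simp add: row sum_distrib_left[symmetric] mult.left_commute)
  have "cnj (e * N) = (\<Sum>i<n. \<Sum>j<n. z $ i * (complex_of_real (A $$ (i,j)) * cnj (z $ j)))"
    unfolding L by simp
  also have "\<dots> = (\<Sum>j<n. \<Sum>i<n. z $ i * (complex_of_real (A $$ (i,j)) * cnj (z $ j)))"
    by (rule sum.swap)
  also have "\<dots> = e * N"
    unfolding L by (intro sum.cong refl) (simp add: a_sym mult.commute mult.left_commute)
  finally have "cnj e = e" using \<open>N \<noteq> 0\<close> by simp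
  then show e: "e = complex_of_real (Re e)" by (simp add: complex_eq_iff)
  have "poly (char_poly ?c) e = 0"
    using ev eigenvalue_root_char_poly[OF c] by simp
  then have "poly (map_poly complex_of_real (char_poly A)) (complex_of_real (Re e)) = 0"
    unfolding of_real_hom.char_poly_hom[OF A] using e by simp
  then have "poly (char_poly A) (Re e) = 0"
    by (simp add: of_real_hom.poly_map_poly)
  then show "eigenvalue A (Re e)" using eigenvalue_root_char_poly[OF A] by simp
qed

lemma upper_triangular_mult:
  fixes X Y :: "'a :: comm_ring_1 mat"
  assumes X: "X \<in> carrier_mat n n" and Y: "Y \<in> carrier_mat n n"
    and "upper_triangular X" "upper_triangular Y"
  shows "upper_triangular (X * Y)"
    and "\<And>i. i < n \<Longrightarrow> (X * Y) $$ (i,i) = X $$ (i,i) * Y $$ (i,i)"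
proof -
  have e: "(X * Y) $$ (i,j) = (\<Sum>k<n. X $$ (i,k) * Y $$ (k,j))" if "i < n" "j < n" for i j
    using that X Y by (simp add: scalar_prod_def atLeast0LessThan)
  have ux: "X $$ (i,j) = 0" if "j < i" "i < n" for i j
    using assms(3) X that by auto
  have uy: "Y $$ (i,j) = 0" if "j < i" "i < n" for i j
    using assms(4) Y that by auto
  show "upper_triangular (X * Y)"
  proof (rule upper_triangularI)
    fix i j assume "j < i" "i < dim_row (X * Y)"
    then have ij: "j < i" "i < n" using X by auto
    have "X $$ (i,k) * Y $$ (k,j) = 0" if "k < n" for k
      using ux[of k i] uy[of j k] ij that by (cases "k < i") auto
    then have "(\<Sum>k<n. X $$ (i,k) * Y $$ (k,j)) = 0" by (intro sum.neutral) simp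
    moreover have "j < n" using ij by simp
    ultimately show "(X * Y) $$ (i,j) = 0" using e[of i j] ij(2) by metis
  qed
  fix i assume i: "i < n"
  have "X $$ (i,k) * Y $$ (k,i) = (if k = i then X $$ (i,i) * Y $$ (i,i) else 0)" if "k < n" for k
    using ux[of k i] uy[of i k] i that by (cases k i rule: linorder_cases) auto
  then have "(\<Sum>k<n. X $$ (i,k) * Y $$ (k,i)) = (\<Sum>k<n. if k = i then X $$ (i,i) * Y $$ (i,i) else 0)"
    by (intro sum.cong) simp_all
  also have "\<dots> = X $$ (i,i) * Y $$ (i,i)" using i by simp
  finally show "(X * Y) $$ (i,i) = X $$ (i,i) * Y $$ (i,i)" unfolding e[OF i i] .
qed

lemma sum_diag_mult_commute:
  fixes X Y :: "'a :: comm_ring_1 mat"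
  assumes "X \<in> carrier_mat n n" "Y \<in> carrier_mat n n"
  shows "(\<Sum>i<n. (X * Y) $$ (i,i)) = (\<Sum>i<n. (Y * X) $$ (i,i))"
proof -
  have "(\<Sum>i<n. (X * Y) $$ (i,i)) = (\<Sum>i<n. \<Sum>k<n. X $$ (i,k) * Y $$ (k,i))"
    using assms by (simp add: scalar_prod_def atLeast0LessThan)
  also have "\<dots> = (\<Sum>k<n. \<Sum>i<n. X $$ (i,k) * Y $$ (k,i))" by (rule sum.swap)
  also have "\<dots> = (\<Sum>i<n. (Y * X) $$ (i,i))"
    using assms by (simp add: scalar_prod_def atLeast0LessThan mult.commute)
  finally show ?thesis .
qed

text \<open>The square of \<open>R = (A - l) (A - r)\<close> has trace zero, as a triangularisation shows,
  and \<open>R\<close> is symmetric, so \<open>R = 0\<close>.\<close>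
lemma symmetric_two_eigenvalues_quadratic:
  fixes A :: "real mat"
  assumes A: "A \<in> carrier_mat n n" and sym: "A\<^sup>T = A"
    and ev: "{k. eigenvalue A k} \<subseteq> {l, r}" and ij: "i < n" "j < n"
  shows "(\<Sum>k<n. A $$ (i,k) * A $$ (k,j)) = (l + r) * A $$ (i,j) - (if i = j then l * r else 0)"
proof -
  let ?h = "map_mat complex_of_real"
  let ?c = "?h A"
  have c: "?c \<in> carrier_mat n n" using A by simp
  obtain es where "char_poly ?c = (\<Prod>e\<leftarrow>es. [:- e, 1:])" using char_poly_factorized[OF c] by auto
  from schur_upper_triangular[OF c this]
  obtain T where T: "T \<in> carrier_mat n n" "upper_triangular T" "similar_mat ?c T" by blast
  have diag: "T $$ (i,i) = complex_of_real l \<or> T $$ (i,i) = complex_of_real r" if i: "i < n" for i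
  proof -
    have "T $$ (i,i) \<in> set (diag_mat T)" using i T(1) unfolding diag_mat_def by auto
    then have "eigenvalue ?c (T $$ (i,i))"
      unfolding eigenvalue_root_char_poly[OF c] char_poly_similar[OF T(3)]
        char_poly_upper_triangular[OF T(1,2)]
      by (auto simp: poly_prod_list prod_list_zero_iff)
    from symmetric_complex_eigenvalue_real[OF A sym this] ev show ?thesis by auto
  qed
  obtain P Q where "similar_mat_wit ?c T P Q" using T(3) unfolding similar_mat_def by blast
  from similar_mat_witD2[OF c this]
  have PQ: "P * Q = 1\<^sub>m n" "Q * P = 1\<^sub>m n" "?c = P * T * Q" "P \<in> carrier_mat n n" "Q \<in> carrier_mat n n"
    by auto
  define U where "U e = T + (- e) \<cdot>\<^sub>m 1\<^sub>m n" for e :: complex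
  have U: "U e \<in> carrier_mat n n" "upper_triangular (U e)" for e
    using T(1,2) unfolding U_def upper_triangular_def by auto
  have Ud: "U e $$ (i,i) = T $$ (i,i) - e" if "i < n" for e i
    using that T(1) by (simp add: U_def)
  \<comment> \<open>\<open>W\<close> is \<open>R\<close> in the triangularising basis. Its diagonal
    entries are (t - l)(t - r) with t equal to l or r, so they vanish, and so do those of
    \<open>W * W\<close>.\<close>
  define W where "W = U l * U r"
  have W: "W \<in> carrier_mat n n" "upper_triangular W"
    unfolding W_def using U by (auto intro: upper_triangular_mult(1)[of _ n] mult_carrier_mat)
  have Wd: "W $$ (i,i) = 0" if "i < n" for i
    using upper_triangular_mult(2)[OF U(1) U(1) U(2) U(2) that] diag[OF that] that
    by (auto simp: W_def Ud)
  define D where "D e = A + (- e) \<cdot>\<^sub>m 1\<^sub>m n" for e :: real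
  have D: "D e \<in> carrier_mat n n" for e using A by (simp add: D_def)
  have hD: "?h (D e) = P * U e * Q" for e
  proof -
    have "P * U e * Q = (P * T + P * ((- complex_of_real e) \<cdot>\<^sub>m 1\<^sub>m n)) * Q"
      using PQ T by (simp add: U_def mult_add_distrib_mat[of _ n n])
    also have "P * ((- complex_of_real e) \<cdot>\<^sub>m 1\<^sub>m n) = (- complex_of_real e) \<cdot>\<^sub>m P"
      using mult_smult_distrib[OF PQ(4) one_carrier_mat] PQ(4) by simp
    also have "(P * T + (- complex_of_real e) \<cdot>\<^sub>m P) * Q
        = P * T * Q + ((- complex_of_real e) \<cdot>\<^sub>m P) * Q"
      using PQ T by (intro add_mult_distrib_mat[of _ n n]) auto
    also have "((- complex_of_real e) \<cdot>\<^sub>m P) * Q = (- complex_of_real e) \<cdot>\<^sub>m 1\<^sub>m n"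
      using mult_smult_assoc_mat[OF PQ(4,5)] PQ(1) by simp
    also have "P * T * Q = ?c" using PQ(3) by simp
    also have "?c + (- complex_of_real e) \<cdot>\<^sub>m 1\<^sub>m n = ?h (D e)" using A by (intro eq_matI) (auto simp: D_def)
    finally show ?thesis by simp
  qed
  have QP: "Q * (P * Z) = Z" if "Z \<in> carrier_mat n n" for Z
    using that PQ by (simp add: assoc_mult_mat[of _ n n _ n _ n, symmetric])
  have conj: "P * X * Q * (P * Y * Q) = P * (X * Y) * Q"
    if X: "X \<in> carrier_mat n n" and Y: "Y \<in> carrier_mat n n" for X Y
    using PQ(4,5) X Y QP[of "Y * Q"] by (simp add: assoc_mult_mat[of _ n n _ n _ n])
  define R where "R = D l * D r"
  have R: "R \<in> carrier_mat n n" unfolding R_def by (rule mult_carrier_mat[OF D D])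
  have "?h R = P * W * Q"
    unfolding R_def W_def
    by (simp add: of_real_hom.mat_hom_mult[OF D D] hD conj[OF U(1) U(1)])
  then have RR: "?h (R * R) = P * (W * W) * Q"
    by (simp add: of_real_hom.mat_hom_mult[OF R R] conj[OF W(1) W(1)])
  have "(\<Sum>i<n. ?h (R * R) $$ (i,i)) = (\<Sum>i<n. (Q * (P * (W * W))) $$ (i,i))"
    unfolding RR using PQ W by (intro sum_diag_mult_commute) auto
  also have "Q * (P * (W * W)) = W * W"
    using QP W by simp
  also have "(\<Sum>i<n. (W * W) $$ (i,i)) = 0"
    using upper_triangular_mult(2)[OF W(1) W(1) W(2) W(2)] Wd by simp
  finally have "complex_of_real (\<Sum>i<n. (R * R) $$ (i,i)) = 0" using R by simp
  then have tr: "(\<Sum>i<n. (R * R) $$ (i,i)) = 0" by (simp only: of_real_eq_0_iff)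
  have a_sym: "A $$ (i,j) = A $$ (j,i)" if "i < n" "j < n" for i j
    using sym A that by (metis carrier_matD index_transpose_mat(1))
  have Rij: "R $$ (i,j) =
      (\<Sum>k<n. A $$ (i,k) * A $$ (k,j)) - (l + r) * A $$ (i,j) + (if i = j then l * r else 0)"
    if "i < n" "j < n" for i j
  proof -
    have "R $$ (i,j) = (\<Sum>k<n. (A $$ (i,k) - (if i = k then l else 0)) *
          (A $$ (k,j) - (if k = j then r else 0)))"
      using that A D unfolding R_def
      by (auto simp: scalar_prod_def atLeast0LessThan D_def intro!: sum.cong)
    also have "\<dots> = (\<Sum>k<n. A $$ (i,k) * A $$ (k,j) - (if k = j then r * A $$ (i,j) else 0)
          - (if k = i then l * A $$ (i,j) else 0) + (if k = i then if i = j then l * r else 0 else 0))"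
      by (intro sum.cong refl) (auto simp: algebra_simps)
    also have "\<dots> = (\<Sum>k<n. A $$ (i,k) * A $$ (k,j)) - (l + r) * A $$ (i,j)
        + (if i = j then l * r else 0)"
      using that by (simp add: sum.distrib sum_subtractf algebra_simps)
    finally show ?thesis .
  qed
  have Rsym: "R $$ (i,j) = R $$ (j,i)" if "i < n" "j < n" for i j
    using that a_sym by (auto simp: Rij mult.commute intro!: sum.cong)
  have "(\<Sum>i<n. (R * R) $$ (i,i)) = (\<Sum>i<n. \<Sum>k<n. (R $$ (i,k))\<^sup>2)"
    using R Rsym by (auto simp: scalar_prod_def atLeast0LessThan power2_eq_square intro!: sum.cong)
  then have "(\<Sum>i<n. \<Sum>k<n. (R $$ (i,k))\<^sup>2) = 0" using tr by simp
  then have "(\<Sum>k<n. (R $$ (i,k))\<^sup>2) = 0"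
    using ij by (subst (asm) sum_nonneg_eq_0_iff) (auto intro: sum_nonneg)
  then have "R $$ (i,j) = 0"
    using ij by (subst (asm) sum_nonneg_eq_0_iff) auto
  with Rij[OF ij] show ?thesis by simp
qed

lemma q_graph_two_symmetric_orthogonal:
  assumes q: "q_graph n E = 2"
  obtains m :: "nat \<Rightarrow> nat \<Rightarrow> real" where
    "\<And>i j. i < n \<Longrightarrow> j < n \<Longrightarrow> m i j = m j i"
    "\<And>i j. i < n \<Longrightarrow> j < n \<Longrightarrow> i \<noteq> j \<Longrightarrow> m i j \<noteq> 0 \<longleftrightarrow> {i, j} \<in> E"
    "\<And>i j. i < n \<Longrightarrow> j < n \<Longrightarrow> (\<Sum>k<n. m i k * m k j) = (if i = j then 1 else 0)"
proof -
  \<comment> \<open>The adjacency matrix shows that \<open>S_graph\<close> is inhabited, so the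
    \<open>LEAST\<close> in \<open>q_graph\<close> is attained by some matrix.\<close>
  let ?A = "mat n n (\<lambda>(i,j). if {i,j} \<in> E then 1 else 0) :: real mat"
  have "?A \<in> S_graph n E"
    unfolding S_graph_def by (auto simp: insert_commute intro!: eq_matI)
  then have "\<exists>k. \<exists>A\<in>S_graph n E. q_mat A = k" by blast
  from LeastI_ex[OF this] obtain A where A: "A \<in> S_graph n E" "q_mat A = 2"
    using q unfolding q_graph_def by auto
  from A(2) obtain l r where lr: "{k. eigenvalue A k} = {l, r}" "l \<noteq> r"
    unfolding q_mat_def card_2_iff by blast
  have Ac: "A \<in> carrier_mat n n" "A\<^sup>T = A" using A(1) by (auto simp: S_graph_def)
  have a_sym: "A $$ (i,j) = A $$ (j,i)" if "i < n" "j < n" for i j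
    using Ac that by (metis carrier_matD index_transpose_mat(1))
  \<comment> \<open>The affine map taking l to 1 and r to -1. It only scales the off-diagonal
    entries, so the zero pattern survives.\<close>
  define m where "m i j = (2 * A $$ (i,j) - (if i = j then l + r else 0)) / (l - r)" for i j
  show ?thesis
  proof
    show "m i j = m j i" if "i < n" "j < n" for i j using a_sym[OF that] by (auto simp: m_def)
    show "m i j \<noteq> 0 \<longleftrightarrow> {i,j} \<in> E" if "i < n" "j < n" "i \<noteq> j" for i j
      using that A(1) lr(2) by (auto simp: m_def S_graph_def)
    fix i j assume ij: "i < n" "j < n"
    have "m i k * m k j = ((2 * A $$ (i,k) - (if i = k then l + r else 0)) *
        (2 * A $$ (k,j) - (if k = j then l + r else 0))) / (l - r)\<^sup>2" for k
      by (simp add: m_def power2_eq_square)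
    then have "(\<Sum>k<n. m i k * m k j) = (\<Sum>k<n. (4 * (A $$ (i,k) * A $$ (k,j))
        - (if k = j then 2 * (l + r) * A $$ (i,j) else 0) - (if k = i then 2 * (l + r) * A $$ (i,j) else 0)
        + (if k = i then if i = j then (l + r)\<^sup>2 else 0 else 0)) / (l - r)\<^sup>2)"
      by (intro sum.cong refl)
        (simp only:, intro arg_cong2[of _ _ _ _ "(/)"] refl,
          auto simp: power2_eq_square algebra_simps)
    also have "\<dots> = (4 * (\<Sum>k<n. A $$ (i,k) * A $$ (k,j)) - 4 * (l + r) * A $$ (i,j)
        + (if i = j then (l + r)\<^sup>2 else 0)) / (l - r)\<^sup>2"
      using ij by (simp add: sum_divide_distrib[symmetric] sum.distrib sum_subtractf
          sum_distrib_left[symmetric])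
    also have "\<dots> = (if i = j then ((l + r)\<^sup>2 - 4 * (l * r)) / (l - r)\<^sup>2 else 0)"
      by (subst symmetric_two_eigenvalues_quadratic[OF Ac equalityD1[OF lr(1)] ij])
        (simp add: algebra_simps)
    also have "\<dots> = (if i = j then 1 else 0)"
    proof -
      have "(l + r)\<^sup>2 - 4 * (l * r) = (l - r)\<^sup>2" by (simp add: power2_eq_square algebra_simps)
      then show ?thesis using lr(2) by simp
    qed
    finally show "(\<Sum>k<n. m i k * m k j) = (if i = j then 1 else 0)" .
  qed
qed

section \<open>Candles and the cube\<close>

lemma simple_graphD:
  assumes "simple_graph V E" "{x, y} \<in> E" shows "x \<in> V" "y \<in> V" "x \<noteq> y"
proof -
  have "E \<subseteq> {{u, v} | u v. u \<in> V \<and> v \<in> V \<and> u \<noteq> v}"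
    using assms(1) by (simp add: simple_graph_def)
  from subsetD[OF this assms(2)]
  obtain u w where "{x, y} = {u, w}" "u \<in> V" "w \<in> V" "u \<noteq> w" by blast
  then show "x \<in> V" "y \<in> V" "x \<noteq> y" by (auto simp: doubleton_eq_iff)
qed

lemma simple_graphE:
  assumes "simple_graph V E" "e \<in> E"
  obtains x y where "e = {x, y}" "x \<in> V" "y \<in> V" "x \<noteq> y"
  using assms unfolding simple_graph_def by blast

lemma graph_iso_sym:
  assumes "graph_iso V E V' E'" shows "graph_iso V' E' V E"
proof -
  obtain f where f: "bij_betw f V V'" "\<And>u v. u \<in> V \<Longrightarrow> v \<in> V \<Longrightarrow> {u, v} \<in> E \<longleftrightarrow> {f u, f v} \<in> E'"
    using assms unfolding graph_iso_def by blast
  let ?g = "the_inv_into V f"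
  have g: "bij_betw ?g V' V" using f(1) by (rule bij_betw_the_inv_into)
  have "{u, v} \<in> E' \<longleftrightarrow> {?g u, ?g v} \<in> E" if "u \<in> V'" "v \<in> V'" for u v
    using f(2)[of "?g u" "?g v"] that bij_betw_apply[OF g] f_the_inv_into_f_bij_betw[OF f(1)] by simp
  with g show ?thesis unfolding graph_iso_def by blast
qed

lemma graph_iso_image:
  assumes f: "bij_betw f V W" and E: "simple_graph V E"
  shows "graph_iso V E W ((`) f ` E)"
proof -
  have inj: "inj_on f V" using f by (simp add: bij_betw_def)
  have "{u, v} \<in> E" if uv: "u \<in> V" "v \<in> V" and img: "{f u, f v} \<in> (`) f ` E" for u v
  proof -
    obtain e where e: "e \<in> E" "{f u, f v} = f ` e" using img by blast
    obtain x y where xy: "e = {x, y}" "x \<in> V" "y \<in> V" using simple_graphE[OF E e(1)] .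
    have "f ` {u, v} = f ` {x, y}" using e(2) xy(1) by simp
    then have "{u, v} = {x, y}" using inj_on_image_eq_iff[OF inj, of "{u, v}" "{x, y}"] uv xy by simp
    with e(1) xy(1) show ?thesis by simp
  qed
  moreover have "{f u, f v} \<in> (`) f ` E" if "{u, v} \<in> E" for u v
    using imageI[OF that, of "(`) f"] by simp
  ultimately show ?thesis using f unfolding graph_iso_def by blast
qed

lemma graph_iso_card:
  assumes iso: "graph_iso V E V' E'" and E: "simple_graph V E" and E': "simple_graph V' E'"
  shows "card E = card E'"
proof -
  obtain f where f: "bij_betw f V V'" "\<And>u v. u \<in> V \<Longrightarrow> v \<in> V \<Longrightarrow> {u, v} \<in> E \<longleftrightarrow> {f u, f v} \<in> E'"
    using iso unfolding graph_iso_def by blast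
  have inj: "inj_on f V" using f(1) by (simp add: bij_betw_def)
  have "E \<subseteq> Pow V"
  proof
    fix e assume e: "e \<in> E"
    obtain x y where "e = {x, y}" "x \<in> V" "y \<in> V" using simple_graphE[OF E e] .
    then show "e \<in> Pow V" by simp
  qed
  then have "inj_on ((`) f) E" using inj by (rule inj_on_subset[OF inj_on_image_Pow, rotated])
  moreover have "(`) f ` E = E'"
  proof (intro equalityI subsetI)
    fix e assume "e \<in> (`) f ` E"
    then obtain e0 where e0: "e0 \<in> E" "e = f ` e0" by blast
    obtain x y where "e0 = {x, y}" "x \<in> V" "y \<in> V" using simple_graphE[OF E e0(1)] .
    with e0 f(2) show "e \<in> E'" by simp
  next
    fix e assume e: "e \<in> E'"
    obtain x y where xy: "e = {x, y}" "x \<in> V'" "y \<in> V'" using simple_graphE[OF E' e] .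
    have "V' = f ` V" using f(1) by (simp add: bij_betw_def)
    then obtain u v where "x = f u" "y = f v" "u \<in> V" "v \<in> V" using xy by blast
    with f(2) e xy(1) show "e \<in> (`) f ` E" by (auto intro!: image_eqI[of _ _ "{u, v}"])
  qed
  ultimately show ?thesis by (metis card_image)
qed

text \<open>Apart from the last edge of a single-ended candle, adjacency in a candle depends only on
  levels. A bijection that respects levels is then nearly an isomorphism, and equal level sizes
  suffice to build one.\<close>

lemma bij_betw_fibres:
  assumes V: "finite V" "finite W"
    and card: "\<And>i. card {x \<in> V. l x = i} = card {y \<in> W. g y = i}"
  obtains f where "bij_betw f V W" "\<And>x. x \<in> V \<Longrightarrow> g (f x) = l x"
proof -
  have "\<exists>h. bij_betw h {x \<in> V. l x = i} {y \<in> W. g y = i}" for i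
    using V card by (intro finite_same_card_bij) auto
  then obtain h where h: "\<And>i. bij_betw (h i) {x \<in> V. l x = i} {y \<in> W. g y = i}" by metis
  define f where "f x = h (l x) x" for x
  have f: "f x \<in> W \<and> g (f x) = l x" if "x \<in> V" for x
    using bij_betw_apply[OF h, of x "l x"] that by (simp add: f_def)
  have "bij_betw f V W"
  proof (rule bij_betwI')
    fix x y assume xy: "x \<in> V" "y \<in> V"
    show "f x = f y \<longleftrightarrow> x = y"
    proof
      assume eq: "f x = f y"
      then have l: "l x = l y" using f xy by metis
      have "inj_on (h (l x)) {z \<in> V. l z = l x}" using h by (simp add: bij_betw_def)
      then show "x = y" using eq l xy unfolding f_def by (auto dest: inj_onD)
    qed simp
  next
    fix y assume "y \<in> W"
    then have "y \<in> h (g y) ` {x \<in> V. l x = g y}" using h[of "g y"] by (simp add: bij_betw_def)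
    then obtain x where "x \<in> V" "l x = g y" "y = h (g y) x" by blast
    then have "y = f x" unfolding f_def by simp
    with \<open>x \<in> V\<close> show "\<exists>x\<in>V. y = f x" by blast
  qed (use f in blast)
  with f that show ?thesis by blast
qed

section \<open>Both candles as members of one family of level graphs\<close>

definition level_edges :: "nat \<Rightarrow> nat set set" where
  "level_edges N = {{u, v} | u v. u \<in> {1..N} \<and> v \<in> {1..N} \<and> v div 2 = u div 2 + 1}"

lemma candle_E_level: "candle_E k = level_edges (2 * k)"
  by (simp add: candle_E_def level_edges_def)

lemma candle1_E_level: "candle1_E k = insert {2 * k, 2 * k + 1} (level_edges (2 * k + 1))"
  by (simp add: candle1_E_def level_edges_def)

lemma level_edges_iff:
  "{x, y} \<in> level_edges N \<longleftrightarrow>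
    x \<in> {1..N} \<and> y \<in> {1..N} \<and> (y div 2 = x div 2 + 1 \<or> x div 2 = y div 2 + 1)"
  unfolding level_edges_def mem_Collect_eq doubleton_eq_iff by metis

lemma simple_level_edges: "simple_graph {1..N} (level_edges N)"
proof -
  have "e \<in> {{u, v} | u v. u \<in> {1..N} \<and> v \<in> {1..N} \<and> u \<noteq> v}" if e: "e \<in> level_edges N" for e
  proof -
    obtain u v where "e = {u, v}" "u \<in> {1..N}" "v \<in> {1..N}" "v div 2 = u div 2 + 1"
      using e unfolding level_edges_def by blast
    moreover from this have "u \<noteq> v" by auto
    ultimately show ?thesis by blast
  qed
  then show ?thesis unfolding simple_graph_def by blast
qed

lemma finite_level_edges: "finite (level_edges N)"
proof (rule finite_subset)
  show "level_edges N \<subseteq> Pow {1..N}" unfolding level_edges_def by blast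
qed simp

text \<open>Adding vertices one at a time treats both candles at once: vertices 2 and 3 bring one
  edge each, every later vertex brings two.\<close>

lemma card_level_edges: "3 \<le> N \<Longrightarrow> card (level_edges N) = 2 * N - 4"
proof (induction N rule: nat_induct_at_least)
  case base
  have "level_edges 3 = {{1, 2}, {1, 3}}"
  proof -
    have "e \<in> {{1, 2}, {1, 3}}" if e: "e \<in> level_edges 3" for e
    proof -
      obtain u v where uv: "e = {u, v}" "u \<in> {1..3}" "v \<in> {1..3}" "v div 2 = u div 2 + 1"
        using e unfolding level_edges_def by blast
      from uv(2-4) have "u = 1 \<and> (v = 2 \<or> v = 3)" unfolding atLeastAtMost_iff by presburger
      with uv(1) show ?thesis by blast
    qed
    moreover have "{1, 2} \<in> level_edges 3" "{1, 3} \<in> level_edges 3" by (simp_all add: level_edges_iff)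
    ultimately show ?thesis by blast
  qed
  then show ?case by (simp add: doubleton_eq_iff)
next
  case (Suc N)
  \<comment> \<open>\<open>p\<close> and \<open>Suc p\<close> form the level just before that of
    \<open>Suc N\<close>; it is a full pair because \<open>Suc N\<close> is at least 4.\<close>
  define p where "p = 2 * (Suc N div 2 - 1)"
  have p: "p div 2 + 1 = Suc N div 2" "Suc p div 2 + 1 = Suc N div 2" "1 \<le> p" "Suc p \<le> N"
    using Suc(1) unfolding p_def by presburger+
  have "level_edges (Suc N) = insert {p, Suc N} (insert {Suc p, Suc N} (level_edges N))"
  proof (intro equalityI subsetI)
    fix e assume "e \<in> level_edges (Suc N)"
    then obtain u v where e: "e = {u, v}" "u \<in> {1..Suc N}" "v \<in> {1..Suc N}" "v div 2 = u div 2 + 1"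
      unfolding level_edges_def by blast
    have "u \<noteq> Suc N"
    proof
      assume "u = Suc N"
      moreover have "v div 2 \<le> Suc N div 2" using e(3) by (intro div_le_mono) simp
      ultimately show False using e(4) by simp
    qed
    then have u: "u \<in> {1..N}" using e(2) by auto
    show "e \<in> insert {p, Suc N} (insert {Suc p, Suc N} (level_edges N))"
    proof (cases "v = Suc N")
      case True
      then have "u div 2 = Suc N div 2 - 1" using e(4) by simp
      then have "u = p \<or> u = Suc p" unfolding p_def using Suc(1) by linarith
      with e(1) True show ?thesis by blast
    next
      case False
      with e u have "e \<in> level_edges N" by (simp add: level_edges_iff)
      then show ?thesis by blast
    qed
  next
    fix e assume e: "e \<in> insert {p, Suc N} (insert {Suc p, Suc N} (level_edges N))"
    have "{1..N} \<subseteq> {1..Suc N}" by auto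
    then have "level_edges N \<subseteq> level_edges (Suc N)" unfolding level_edges_def by blast
    moreover have "{p, Suc N} \<in> level_edges (Suc N)" "{Suc p, Suc N} \<in> level_edges (Suc N)"
      using p unfolding level_edges_iff by auto
    ultimately show "e \<in> level_edges (Suc N)" using e by blast
  qed
  moreover have "{x, Suc N} \<notin> level_edges N" for x by (simp add: level_edges_iff)
  moreover have "{p, Suc N} \<noteq> {Suc p, Suc N}" by (auto simp: doubleton_eq_iff)
  ultimately have "card (level_edges (Suc N)) = Suc (Suc (card (level_edges N)))"
    using finite_level_edges by simp
  with Suc show ?case by simp
qed

lemma card_candle: "2 \<le> k \<Longrightarrow> card (candle_E k) = 2 * (2 * k) - 4"
  by (simp add: candle_E_level card_level_edges)

lemma card_candle1: "1 \<le> k \<Longrightarrow> card (candle1_E k) = 2 * (2 * k + 1) - 3"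
  by (simp add: candle1_E_level card_level_edges finite_level_edges level_edges_iff)

lemma simple_candle: "simple_graph (candle_V k) (candle_E k)"
  unfolding candle_V_def candle_E_level by (rule simple_level_edges)

lemma simple_candle1: "1 \<le> k \<Longrightarrow> simple_graph (candle1_V k) (candle1_E k)"
proof -
  assume "1 \<le> k"
  then have "2 * k \<in> {1..2 * k + 1}" "2 * k + 1 \<in> {1..2 * k + 1}" "2 * k \<noteq> 2 * k + 1" by auto
  then show ?thesis
    using simple_level_edges[of "2 * k + 1"]
    unfolding simple_graph_def candle1_V_def candle1_E_level by blast
qed

lemma card_candle_level:
  fixes i k :: nat
  shows "card {y \<in> {1..2 * k}. y div 2 = i} = (if i = 0 \<or> i = k then if k = 0 then 0 else 1 else if i < k then 2 else 0)"
proof -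
  have "{y \<in> {1..2 * k}. y div 2 = i} =
    (if i > k \<or> k = 0 then {} else if i = 0 then {1} else if i = k then {2 * k} else {2 * i, 2 * i + 1})"
    by auto
  then show ?thesis by auto
qed

lemma card_candle1_level:
  fixes i k :: nat
  shows "card {y \<in> {1..2 * k + 1}. y div 2 = i} = (if i = 0 then 1 else if i \<le> k then 2 else 0)"
proof -
  have "{y \<in> {1..2 * k + 1}. y div 2 = i} =
    (if i > k then {} else if i = 0 then {1} else {2 * i, 2 * i + 1})"
    by auto
  then show ?thesis by auto
qed

text \<open>There are only 64 ordered pairs of vertices. Once the cardinality is rewritten as a sum
  of three truth values, each pair can be evaluated; the list \<open>?l\<close> holds every edge in
  both orientations.\<close>

lemma Q3_E_eq:
  "Q3_E = {{0,1}, {0,2}, {0,4}, {1,3}, {1,5}, {2,3}, {2,6}, {4,5}, {4,6}, {3,7}, {5,7}, {6,7}}"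
  (is "_ = ?E")
proof -
  let ?bits = "\<lambda>u v :: nat. of_bool (odd u \<noteq> odd v) + of_bool (odd (u div 2) \<noteq> odd (v div 2))
    + of_bool (odd (u div 4) \<noteq> odd (v div 4)) :: nat"
  let ?l = "[(0,1), (0,2), (0,4), (1,3), (1,5), (2,3), (2,6), (4,5), (4,6), (3,7), (5,7), (6,7),
     (1,0), (2,0), (4,0), (3,1), (5,1), (3,2), (6,2), (5,4), (6,4), (7,3), (7,5), (7,6)] :: (nat \<times> nat) list"
  have less_8: "(\<forall>u<8::nat. P u) \<longleftrightarrow> P 0 \<and> P 1 \<and> P 2 \<and> P 3 \<and> P 4 \<and> P 5 \<and> P 6 \<and> P 7" for P
    by (simp add: numeral_eq_Suc All_less_Suc2 conj_assoc)
  have count: "card {b. b < 3 \<and> P b} = of_bool (P 0) + of_bool (P 1) + of_bool (P 2)"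
    for P :: "nat \<Rightarrow> bool"
  proof -
    have "b < 3 \<longleftrightarrow> b = 0 \<or> b = 1 \<or> b = 2" for b :: nat by linarith
    then have "{b. b < 3 \<and> P b} = set (filter P [0, 1, 2])" unfolding set_filter by simp
    then show ?thesis by (cases "P 0"; cases "P 1"; cases "P 2") simp_all
  qed
  have table: "\<forall>u<8. \<forall>v<8. ?bits u v = 1 \<longleftrightarrow> (u, v) \<in> set ?l" unfolding less_8 by simp
  have bound: "\<forall>(u, v)\<in>set ?l. u < 8 \<and> v < 8" by simp
  have "u < 8 \<and> v < 8 \<and> card {b. b < 3 \<and> odd (u div 2 ^ b) \<noteq> odd (v div 2 ^ b)} = 1
      \<longleftrightarrow> (u, v) \<in> set ?l" for u v
  proof (cases "u < 8 \<and> v < 8")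
    case True
    with table True show ?thesis unfolding count by simp
  next
    case False with bound show ?thesis by blast
  qed
  then have "Q3_E = {{u, v} | u v. (u, v) \<in> set ?l}" unfolding Q3_E_def by simp
  also have "\<dots> = (\<lambda>(u, v). {u, v}) ` set ?l" by (auto simp del: list.set)
  also have "\<dots> = ?E" by (simp add: insert_commute)
  finally show ?thesis .
qed

lemma card_Q3: "card Q3_E = 12"
  unfolding Q3_E_eq by (simp add: doubleton_eq_iff)

lemma simple_Q3: "simple_graph Q3_V Q3_E"
proof -
  have "u \<noteq> v" if "card {b. b < 3 \<and> odd (u div 2 ^ b) \<noteq> odd (v div 2 ^ b)} = 1" for u v :: nat
    using that by auto
  moreover have "{0..<8} = {u :: nat. u < 8}" by auto
  ultimately show ?thesis unfolding simple_graph_def Q3_V_def Q3_E_def by blast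
qed

section \<open>Graphs of symmetric orthogonal matrices\<close>

locale orthogonal_graph =
  fixes n :: nat and E :: "nat set set" and m :: "nat \<Rightarrow> nat \<Rightarrow> real"
  assumes n_ge_3: "n \<ge> 3"
    and simple: "simple_graph {0..<n} E"
    and connected: "graph_connected {0..<n} E"
    and m_sym: "\<And>i j. i < n \<Longrightarrow> j < n \<Longrightarrow> m i j = m j i"
    and m_pattern: "\<And>i j. i < n \<Longrightarrow> j < n \<Longrightarrow> i \<noteq> j \<Longrightarrow> m i j \<noteq> 0 \<longleftrightarrow> {i, j} \<in> E"
    and m_orth: "\<And>i j. i < n \<Longrightarrow> j < n \<Longrightarrow> (\<Sum>k<n. m i k * m k j) = (if i = j then 1 else 0)"
begin

abbreviation adj :: "nat \<Rightarrow> nat \<Rightarrow> bool" where "adj x y \<equiv> {x, y} \<in> E"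

definition nbrs :: "nat \<Rightarrow> nat set" where "nbrs x = {y. adj x y}"

lemma adjD: assumes "adj x y" shows "x < n" "y < n" "x \<noteq> y"
  using simple_graphD[OF simple assms] by auto

lemma adj_sym: "adj x y \<longleftrightarrow> adj y x"
  by (simp add: insert_commute)

lemma edgeE:
  assumes "e \<in> E" obtains x y where "e = {x, y}" "x < y" "adj x y"
proof -
  obtain u v where "e = {u, v}" "u \<noteq> v" using assms simple unfolding simple_graph_def by blast
  with assms that[of u v] that[of v u] show ?thesis by (cases "u < v") (auto simp: insert_commute)
qed

lemma nbrs_bound: "nbrs x \<subseteq> {..<n}"
  using adjD unfolding nbrs_def by auto

lemma finite_nbrs [simp]: "finite (nbrs x)"
  by (rule finite_subset[OF nbrs_bound]) simp

lemma finite_E: "finite E"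
proof -
  have "e \<in> Pow {0..<n}" if e: "e \<in> E" for e
  proof -
    obtain x y where "e = {x, y}" "adj x y" using e edgeE by blast
    then show ?thesis using adjD[of x y] by simp
  qed
  then show ?thesis by (intro finite_subset[of E "Pow {0..<n}"]) auto
qed

lemma m_nonzero: "adj i j \<Longrightarrow> m i j \<noteq> 0"
  using m_pattern adjD by blast

text \<open>The diagonal of \<open>m\<close> is unknown, but it enters the scalar product of rows
  \<open>i\<close> and \<open>j\<close> only through terms with the factor \<open>m i j\<close>,
  which is zero here. What remains is a sum over common neighbours.\<close>

lemma nonadjacent_sum:
  assumes "i < n" "j < n" "i \<noteq> j" "\<not> adj i j"
  shows "(\<Sum>k | adj i k \<and> adj k j. m i k * m k j) = 0"
proof -
  have ij0: "m i j = 0" using m_pattern assms by blast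
  have "(\<Sum>k<n. m i k * m k j) = (\<Sum>k | adj i k \<and> adj k j. m i k * m k j)"
  proof (rule sum.mono_neutral_right)
    show "{k. adj i k \<and> adj k j} \<subseteq> {..<n}" using adjD by auto
    show "\<forall>k\<in>{..<n} - {k. adj i k \<and> adj k j}. m i k * m k j = 0"
    proof
      fix k assume k: "k \<in> {..<n} - {k. adj i k \<and> adj k j}"
      then have "k = i \<or> k = j \<or> m i k = 0 \<or> m k j = 0"
        using m_pattern[of i k] m_pattern[of k j] assms(1,2) by auto
      with ij0 show "m i k * m k j = 0" by auto
    qed
  qed simp
  with m_orth[OF assms(1,2)] assms(3) show ?thesis by simp
qed

text \<open>A sum with just one nonzero term cannot vanish.\<close>

lemma other_common_neighbour:
  assumes "i \<noteq> j" "\<not> adj i j" "adj i x" "adj x j"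
  obtains y where "y \<noteq> x" "adj i y" "adj y j"
proof -
  have "\<exists>y. y \<noteq> x \<and> adj i y \<and> adj y j"
  proof (rule ccontr)
    assume "\<not> ?thesis"
    then have "{k. adj i k \<and> adj k j} = {x}" using assms by blast
    moreover have "(\<Sum>k | adj i k \<and> adj k j. m i k * m k j) = 0"
      using assms adjD by (intro nonadjacent_sum) blast+
    ultimately have "m i x * m x j = 0" by simp
    with m_nonzero assms show False by auto
  qed
  with that show ?thesis by blast
qed

lemma adj_exists: assumes "x < n" obtains y where "adj x y"
proof -
  obtain z where z: "z < n" "z \<noteq> x" using n_ge_3 that[of 0] that[of 1] by force
  then have "(x, z) \<in> {(a, b). {a, b} \<in> E}\<^sup>*"
    using connected assms unfolding graph_connected_def by auto
  then show ?thesis using z(2) that by (cases rule: converse_rtranclE) auto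
qed

text \<open>If \<open>y\<close> were the only neighbour of \<open>x\<close>, any further neighbour
  of \<open>y\<close> would share with \<open>x\<close> the single common neighbour
  \<open>y\<close>. So \<open>x\<close> and \<open>y\<close> would form a whole component, too small
  for n at least 3.\<close>

lemma degree_ge_2: assumes x: "x < n" shows "2 \<le> card (nbrs x)"
proof (rule ccontr)
  assume less: "\<not> ?thesis"
  obtain y where y: "adj x y" using adj_exists[OF x] .
  have only: "z = y" if "adj x z" for z
  proof (rule ccontr)
    assume "z \<noteq> y"
    then have "card {z, y} = 2" by simp
    moreover have "card {z, y} \<le> card (nbrs x)"
      using y that by (intro card_mono finite_nbrs) (auto simp: nbrs_def)
    ultimately show False using less by simp
  qed
  have "card {x, y} \<le> 2" using card_insert_le_m1[of 2 "{y}" x] by simp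
  then have "\<not> {..<n} \<subseteq> {x, y}" using n_ge_3 card_mono[of "{x, y}" "{..<n}"] by force
  then obtain z where z: "z < n" "z \<noteq> x" "z \<noteq> y" by blast
  have y_only: "w = x" if "adj y w" for w
  proof (rule ccontr)
    assume "w \<noteq> x"
    moreover have "\<not> adj x w" using only[of w] adjD[OF that] by auto
    ultimately show False using other_common_neighbour[of x w y] y that only by metis
  qed
  have "(x, z) \<in> {(a, b). {a, b} \<in> E}\<^sup>*"
    using connected x z unfolding graph_connected_def by auto
  then have "z = x \<or> z = y"
    by (induction rule: rtrancl_induct) (use only y_only in auto)
  with z show False by blast
qed

lemma sum_degrees: "(\<Sum>x<n. card (nbrs x)) = 2 * card E"
proof -
  let ?U = "{(x, y). x < y \<and> adj x y}" and ?D = "{(x, y). y < x \<and> adj x y}"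
  have sub: "?U \<subseteq> {..<n} \<times> {..<n}" "?D \<subseteq> {..<n} \<times> {..<n}" using adjD by auto
  have fin: "finite ?U" "finite ?D" using sub by (auto intro: finite_subset)
  have "bij_betw (\<lambda>(x, y). {x, y}) ?U E"
  proof (rule bij_betwI')
    fix e assume "e \<in> E"
    then show "\<exists>p\<in>?U. e = (case p of (x, y) \<Rightarrow> {x, y})" by (rule edgeE) auto
  qed (auto simp: doubleton_eq_iff)
  then have U: "card ?U = card E" by (rule bij_betw_same_card)
  have "bij_betw (\<lambda>(x, y). (y, x)) ?U ?D"
    by (rule bij_betwI[where g = "\<lambda>(x, y). (y, x)"]) (auto simp: insert_commute)
  then have D: "card ?D = card E" using U bij_betw_same_card by force
  have "(\<Sum>x<n. card (nbrs x)) = card (SIGMA x:{..<n}. nbrs x)" by simp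
  also have "(SIGMA x:{..<n}. nbrs x) = ?U \<union> ?D"
    using adjD by (auto simp: nbrs_def) (meson linorder_neqE_nat)
  also have "card (?U \<union> ?D) = card ?U + card ?D"
    using fin by (intro card_Un_disjoint) auto
  finally show ?thesis using U D by simp
qed

end

section \<open>Distance levels from a root and the edge count\<close>

locale rooted_orthogonal_graph = orthogonal_graph +
  fixes v :: nat
  assumes v_less: "v < n"
begin

definition lev :: "nat \<Rightarrow> nat" where
  "lev x = (LEAST k. (v, x) \<in> {(a, b). adj a b} ^^ k)"

definition down :: "nat \<Rightarrow> nat set" where
  "down x = {y. adj x y \<and> lev x = Suc (lev y)}"

definition S :: "nat set set" where
  "S = {{x, y} | x y. adj x y \<and> lev x = lev y}"

definition L :: "nat \<Rightarrow> nat set" where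
  "L i = {x. x < n \<and> lev x = i}"

lemma lev_le: "(v, x) \<in> {(a, b). adj a b} ^^ k \<Longrightarrow> lev x \<le> k"
  unfolding lev_def by (rule Least_le)

lemma lev_path: assumes "x < n" shows "(v, x) \<in> {(a, b). adj a b} ^^ lev x"
proof -
  have "(v, x) \<in> {(a, b). {a, b} \<in> E}\<^sup>*"
    using connected assms v_less unfolding graph_connected_def by auto
  then have "\<exists>k. (v, x) \<in> {(a, b). adj a b} ^^ k" by (rule rtrancl_imp_relpow)
  then show ?thesis unfolding lev_def by (rule LeastI_ex)
qed

lemma lev_v [simp]: "lev v = 0"
  using lev_le[of v 0] by simp

lemma lev_0D: "x < n \<Longrightarrow> lev x = 0 \<Longrightarrow> x = v"
  using lev_path[of x] by simp

lemma lev_adj: assumes "adj x y" shows "lev y \<le> Suc (lev x)"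
proof -
  have "(v, y) \<in> {(a, b). adj a b} ^^ Suc (lev x)"
    using lev_path[of x] adjD[OF assms] assms by auto
  then show ?thesis by (rule lev_le)
qed

lemma lev_adj_cases:
  assumes "adj x y"
  obtains "lev x = lev y" | "lev x = Suc (lev y)" | "lev y = Suc (lev x)"
  using lev_adj[OF assms] lev_adj[of y x] assms
  by (metis adj_sym le_SucE le_antisym)

lemma downI: "adj x y \<Longrightarrow> lev x = Suc (lev y) \<Longrightarrow> y \<in> down x"
  by (simp add: down_def)

lemma downD: assumes "y \<in> down x" shows "adj x y" "adj y x" "lev x = Suc (lev y)" "x < n" "y < n"
  using assms adjD unfolding down_def by (auto simp: insert_commute)

lemma finite_down [simp]: "finite (down x)"
  by (rule finite_subset[of _ "{..<n}"]) (use downD in auto)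

lemma finite_L [simp]: "finite (L i)"
  by (simp add: L_def)

lemma down_sub_L: "down x \<subseteq> L (lev x - 1)"
  using downD by (auto simp: L_def)

lemma SI: "adj x y \<Longrightarrow> lev x = lev y \<Longrightarrow> {x, y} \<in> S"
  unfolding S_def by blast

lemma SD: assumes "{x, y} \<in> S" shows "adj x y" "lev x = lev y"
  using assms unfolding S_def by (auto simp: doubleton_eq_iff insert_commute)

lemma finite_S [simp]: "finite S"
  by (rule finite_subset[OF _ finite_E]) (auto simp: S_def)

lemma adj_cases: "adj x y \<Longrightarrow> y \<in> down x \<or> x \<in> down y \<or> {x, y} \<in> S"
  by (metis lev_adj_cases downI SI adj_sym)

lemma down_exists: assumes "x < n" "lev x \<noteq> 0" obtains y where "y \<in> down x"
proof -
  obtain k where k: "lev x = Suc k" using assms(2) by (cases "lev x") auto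
  then have "(v, x) \<in> {(a, b). adj a b} ^^ Suc k" using lev_path[OF assms(1)] by simp
  then obtain y where y: "(v, y) \<in> {(a, b). adj a b} ^^ k" "adj y x" by auto
  then have "lev y \<le> k" "lev x \<le> Suc (lev y)" using lev_le lev_adj by auto
  with k y(2) have "y \<in> down x" by (intro downI) (auto simp: insert_commute)
  with that show ?thesis .
qed

lemma lev_below: assumes "x < n" "k \<le> lev x" obtains y where "y < n" "lev y = k"
proof -
  have "\<exists>y<n. lev y = k"
    using assms
  proof (induction "lev x - k" arbitrary: x)
    case 0 then show ?case by (metis diff_is_0_eq le_antisym)
  next
    case (Suc d)
    then obtain y where y: "y \<in> down x" using down_exists[of x] by (metis diff_0_eq_0 nat.distinct(1))
    from Suc(1)[of y] Suc(2,4) downD[OF y] show ?case by auto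
  qed
  with that show ?thesis by blast
qed

lemma down_between:
  assumes "adj p w" "adj w h" "lev h = Suc (Suc (lev p))" shows "w \<in> down h" "p \<in> down w"
proof -
  have "lev w = Suc (lev p)" using lev_adj[OF assms(1)] lev_adj[OF assms(2)] assms(3) by simp
  then show "w \<in> down h" "p \<in> down w" using assms by (auto intro!: downI simp: insert_commute)
qed

text \<open>Vertices two levels apart are never adjacent, so the common-neighbour rule always
  applies to them, and all their common neighbours lie on the level between.\<close>

lemma other_down:
  assumes g: "g \<in> down h" and p: "p \<in> down g"
  obtains g' where "g' \<noteq> g" "g' \<in> down h" "p \<in> down g'"
proof -
  have lev: "lev h = Suc (Suc (lev p))" using downD[OF g] downD[OF p] by simp
  then have "\<not> adj p h" "p \<noteq> h" using lev_adj[of p h] by auto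
  then obtain g' where "g' \<noteq> g" "adj p g'" "adj g' h"
    using other_common_neighbour[of p h g] downD[OF g] downD[OF p] by blast
  with that down_between lev show ?thesis by blast
qed

text \<open>Each vertex below \<open>g1\<close> must be reached from \<open>h\<close> in a second
  way, and only \<open>g2\<close> is left for that. This is the main source of rigidity in both
  degree cases.\<close>

lemma down_pair_eq:
  assumes h: "down h = {g1, g2}" shows "down g1 = down g2"
proof -
  have "down g \<subseteq> down g'" if "down h = {g, g'}" for g g'
    using other_down[of g h] that by (metis insertE insertI1 singletonD subsetI)
  from this[of g1 g2] this[of g2 g1] h show ?thesis by (simp add: insert_commute)
qed

lemma card_down_ge_2: assumes "x < n" "2 \<le> lev x" shows "2 \<le> card (down x)"
proof -
  obtain g where g: "g \<in> down x" using down_exists[of x] assms by auto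
  then obtain p where p: "p \<in> down g" using down_exists[of g] downD[OF g] assms by auto
  obtain g' where "g' \<noteq> g" "g' \<in> down x" using other_down[OF g p] .
  with g have "card {g, g'} \<le> card (down x)" by (intro card_mono) auto
  with \<open>g' \<noteq> g\<close> show ?thesis by auto
qed

lemma L_0: "L 0 = {v}"
  using lev_0D v_less by (auto simp: L_def)

lemma L_1: "L 1 = nbrs v"
proof (intro equalityI subsetI)
  fix x assume "x \<in> L 1"
  then have x: "x < n" "lev x = 1" by (auto simp: L_def)
  then obtain y where y: "y \<in> down x" using down_exists[of x] by auto
  then have "y = v" using downD[OF y] x lev_0D by auto
  with y show "x \<in> nbrs v" using downD by (auto simp: nbrs_def)
next
  fix x assume "x \<in> nbrs v"
  then have "adj v x" by (simp add: nbrs_def)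
  with lev_adj[of v x] adjD[of v x] lev_0D[of x] show "x \<in> L 1" by (cases "lev x") (auto simp: L_def)
qed

lemma lev_1_adj: "x < n \<Longrightarrow> lev x = 1 \<Longrightarrow> adj v x"
  using L_1 by (auto simp: L_def nbrs_def)

lemma down_lev_1: assumes "x < n" "lev x = 1" shows "down x = {v}"
  using lev_1_adj[OF assms] assms downD(3,5)[of _ x] lev_0D
  by (auto intro!: downI simp: insert_commute)

lemma down_v: "down v = {}"
  using downD(3)[of _ v] by auto

lemma card_E_down: "card E = card S + (\<Sum>x<n. card (down x))"
proof -
  let ?f = "\<lambda>(x, y). {x, y} :: nat set" and ?P = "SIGMA x:{..<n}. down x"
  have "inj_on ?f ?P"
    by (rule inj_onI) (auto simp: doubleton_eq_iff dest!: downD(3))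
  then have "card (?f ` ?P) = (\<Sum>x<n. card (down x))" by (simp add: card_image)
  moreover have E_eq: "E = S \<union> ?f ` ?P"
  proof
    show "S \<union> ?f ` ?P \<subseteq> E" using downD(1) unfolding S_def by auto
    show "E \<subseteq> S \<union> ?f ` ?P"
    proof
      fix e assume "e \<in> E"
      then show "e \<in> S \<union> ?f ` ?P"
      proof (rule edgeE)
        fix x y assume e: "e = {x, y}" and a: "adj x y"
        from adj_cases[OF a] adjD[OF a] show ?thesis
          unfolding e by (auto simp: image_iff)
      qed
    qed
  qed
  moreover have "S \<inter> ?f ` ?P = {}"
  proof -
    have "{x, y} \<notin> S" if "y \<in> down x" for x y using SD(2)[of x y] downD(3)[OF that] by auto
    then show ?thesis by auto
  qed
  moreover have "finite (?f ` ?P)" by simp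
  ultimately have "card (S \<union> ?f ` ?P) = card S + (\<Sum>x<n. card (down x))"
    using card_Un_disjoint[OF finite_S, of "?f ` ?P"] by metis
  then show ?thesis unfolding E_eq[symmetric] .
qed

text \<open>The number t of the overview. The subtraction is exact by
  \<open>card_down_ge_2\<close>.\<close>

definition excess :: nat where
  "excess = (\<Sum>x | x < n \<and> 2 \<le> lev x. card (down x) - 2)"

text \<open>Levels 0 and 1 have 1 + d vertices but only d downward edges, so 2 + d is lost from 2n.
  The loss stands on the left to avoid truncated subtraction.\<close>

lemma card_E: "card E + card (nbrs v) + 2 = 2 * n + card S + excess"
proof -
  let ?V = "{x. x < n \<and> 2 \<le> lev x}"
  have dec: "{..<n} = {v} \<union> (nbrs v \<union> ?V)"
  proof -
    have "x \<in> L 0 \<union> (L 1 \<union> ?V)" if "x < n" for x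
      using that by (cases "lev x = 0"; cases "lev x = 1") (auto simp: L_def)
    moreover have "L 0 \<union> (L 1 \<union> ?V) \<subseteq> {..<n}" by (auto simp: L_def)
    ultimately show ?thesis unfolding L_0 L_1 by blast
  qed
  have lv: "x \<in> nbrs v \<Longrightarrow> lev x = 1 \<and> x < n" for x using L_1 by (auto simp: L_def)
  have split: "sum f {..<n} = f v + (sum f (nbrs v) + sum f ?V)" for f :: "nat \<Rightarrow> nat"
  proof -
    have "nbrs v \<inter> ?V = {}" "v \<notin> nbrs v \<union> ?V" using lv by fastforce+
    then show ?thesis unfolding dec by (simp add: sum.union_disjoint)
  qed
  have n: "n = 1 + (card (nbrs v) + card ?V)" using split[of "\<lambda>_. 1"] by simp
  have "(\<Sum>x\<in>?V. card (down x)) = (\<Sum>x\<in>?V. (card (down x) - 2) + 2)"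
  proof (intro sum.cong refl)
    fix x assume "x \<in> ?V"
    then show "card (down x) = card (down x) - 2 + 2" using card_down_ge_2[of x] by simp
  qed
  also have "\<dots> = excess + 2 * card ?V" by (simp only: excess_def sum.distrib) simp
  finally have "(\<Sum>x<n. card (down x)) = card (nbrs v) + (excess + 2 * card ?V)"
    using split[of "\<lambda>x. card (down x)"] down_v down_lev_1 lv by simp
  with card_E_down n show ?thesis by linarith
qed

end

section \<open>Two facts that use the values of the matrix entries\<close>

context rooted_orthogonal_graph
begin

text \<open>With \<open>S\<close> empty, the parity of the level is a bipartition. All rows turn out
  to have the same off-diagonal norm, and summing the squared entries between the two sides by rows
  and by columns makes the sides equally large.\<close>

lemma bipartite_even:
  assumes "S = {}" shows "even n"
proof -
  have lev_ne: "lev x \<noteq> lev y" if "adj x y" for x y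
    using SI[OF that] assms by auto
  have par: "even (lev x) \<longleftrightarrow> odd (lev y)" if "adj x y" for x y
    using lev_adj_cases[OF that] lev_ne[OF that] by fastforce
  \<comment> \<open>Adjacent vertices have no common neighbour in a bipartite graph, so
    orthogonality of their rows involves only the two diagonal entries and makes these opposite.
    Connectedness then spreads the square to all vertices.\<close>
  have diag: "(m y y)\<^sup>2 = (m x x)\<^sup>2" if a: "adj x y" for x y
  proof -
    note xy = adjD[OF a]
    have "m x k * m k y = 0" if "k < n" "k \<noteq> x" "k \<noteq> y" for k
    proof (rule ccontr)
      assume "m x k * m k y \<noteq> 0"
      then have "adj x k" "adj k y" using m_pattern that xy by auto
      with par[of x k] par[of k y] par[OF a] show False by blast
    qed
    then have "(\<Sum>k<n. m x k * m k y) = (\<Sum>k\<in>{x, y}. m x k * m k y)"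
      using xy by (intro sum.mono_neutral_right) auto
    then have "m x y * (m x x + m y y) = 0"
      using m_orth[of x y] xy by (simp add: algebra_simps)
    then have "m x x + m y y = 0" using m_nonzero[OF a] by simp
    then have "m y y = - m x x" by linarith
    then show ?thesis by simp
  qed
  define c where "c = (m v v)\<^sup>2"
  have c: "(m x x)\<^sup>2 = c" if "x < n" for x
    using that
  proof (induction "lev x" arbitrary: x)
    case 0
    then have "x = v" using lev_0D[of x] by simp
    then show ?case by (simp add: c_def)
  next
    case (Suc d)
    then obtain y where y: "y \<in> down x" using down_exists[of x] by auto
    with Suc downD[OF y] diag[of y x] show ?case by auto
  qed
  have row: "(\<Sum>y | y < n \<and> P y. (m x y)\<^sup>2) = 1 - c"
    if x: "x < n" and P: "\<And>y. P y \<Longrightarrow> y \<noteq> x" "\<And>y. adj x y \<Longrightarrow> P y" for x P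
  proof -
    have "1 = (\<Sum>y<n. (m x y)\<^sup>2)"
      using m_orth[OF x x] m_sym x by (simp add: power2_eq_square)
    also have "\<dots> = (\<Sum>y\<in>insert x {y. y < n \<and> P y}. (m x y)\<^sup>2)"
    proof (rule sum.mono_neutral_right)
      show "\<forall>y\<in>{..<n} - insert x {y. y < n \<and> P y}. (m x y)\<^sup>2 = 0"
        using m_pattern[of x] x P by auto
    qed (use x in auto)
    also have "\<dots> = c + (\<Sum>y | y < n \<and> P y. (m x y)\<^sup>2)"
      using P(1) c[OF x] by (subst sum.insert) auto
    finally show ?thesis by simp
  qed
  define X Y where "X = {x. x < n \<and> even (lev x)}" and "Y = {x. x < n \<and> odd (lev x)}"
  have fin: "finite X" "finite Y" by (auto simp: X_def Y_def)
  have "(\<Sum>x\<in>X. \<Sum>y\<in>Y. (m x y)\<^sup>2) = real (card X) * (1 - c)"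
  proof -
    have "(\<Sum>y\<in>Y. (m x y)\<^sup>2) = 1 - c" if "x \<in> X" for x
      using row[of x "\<lambda>y. odd (lev y)"] par[of x] that by (auto simp: X_def Y_def)
    then show ?thesis by simp
  qed
  moreover have "(\<Sum>x\<in>X. \<Sum>y\<in>Y. (m x y)\<^sup>2) = (\<Sum>y\<in>Y. \<Sum>x\<in>X. (m y x)\<^sup>2)"
    using m_sym by (subst sum.swap) (auto simp: X_def Y_def intro!: sum.cong)
  moreover have "(\<Sum>y\<in>Y. \<Sum>x\<in>X. (m y x)\<^sup>2) = real (card Y) * (1 - c)"
  proof -
    have "(\<Sum>y\<in>X. (m x y)\<^sup>2) = 1 - c" if "x \<in> Y" for x
      using row[of x "\<lambda>y. even (lev y)"] par[of x] that by (auto simp: X_def Y_def)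
    then show ?thesis by simp
  qed
  ultimately have eq: "real (card X) * (1 - c) = real (card Y) * (1 - c)" by linarith
  \<comment> \<open>Needed to cancel 1 - c: for c = 1 the row of \<open>v\<close> would vanish off
    the diagonal, although \<open>v\<close> has a neighbour.\<close>
  have "c \<noteq> 1"
  proof
    assume "c = 1"
    obtain y where y: "adj v y" using adj_exists[OF v_less] .
    have ne: "u \<noteq> v" if "adj v u" for u using adjD(3)[OF that] by simp
    have "(\<Sum>y | y < n \<and> y \<noteq> v. (m v y)\<^sup>2) = 0"
      using row[OF v_less, of "\<lambda>y. y \<noteq> v", OF _ ne] \<open>c = 1\<close> by simp
    then have "(m v y)\<^sup>2 = 0"
      using adjD[OF y] by (subst (asm) sum_nonneg_eq_0_iff) auto
    with m_nonzero[OF y] show False by simp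
  qed
  with eq have "card X = card Y" by simp
  moreover have "X \<union> Y = {..<n}" "X \<inter> Y = {}" by (auto simp: X_def Y_def)
  ultimately have "n = 2 * card X" using card_Un_disjoint[OF fin] by simp
  then show ?thesis by simp
qed

text \<open>The middle vertex lies below, beside or above both ends. For distinct ends the second
  case costs two edges of \<open>S\<close>, which is what makes it easy to exclude.\<close>

lemma two_path_level:
  assumes "adj p w" "adj w q" "lev p = lev q"
  obtains "w \<in> down p" "w \<in> down q" | "{p, w} \<in> S" "{q, w} \<in> S" | "p \<in> down w" "q \<in> down w"
proof -
  have a: "adj w p" "adj q w" using assms adj_sym by blast+
  show ?thesis
  proof (cases rule: lev_adj_cases[OF assms(1)])
    case 1 with that(2) SI assms a show ?thesis by simp
  next
    case 2 with that(1) downI assms a show ?thesis by simp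
  next
    case 3 with that(3) downI assms a show ?thesis by simp
  qed
qed

text \<open>Rows at distance two that meet in exactly two columns determine each other there up to a
  factor, and two vectors in a plane orthogonal to a common third one are not orthogonal.\<close>
lemma common_neighbour_outside_pair:
  assumes z: "down z = {x, y}" "down z' = {x, y}" and "x \<noteq> y" "z \<noteq> z'" "\<not> adj z z'"
    and lev: "2 \<le> lev z"
  obtains w where "w \<notin> {x, y}" "adj z w" "adj w z'"
proof -
  have "\<exists>w. w \<notin> {x, y} \<and> adj z w \<and> adj w z'"
  proof (rule ccontr)
    assume no: "\<not> ?thesis"
    have x: "x \<in> down z" "x \<in> down z'" and y: "y \<in> down z" "y \<in> down z'" using z by auto
    have lz: "lev z' = lev z" using downD(3)[OF x(1)] downD(3)[OF x(2)] by simp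
    \<comment> \<open>Row \<open>a\<close> supplies the third vector: \<open>a\<close> lies two
      levels below \<open>z\<close> and \<open>z'\<close>, and its common neighbours with each are
      exactly \<open>x\<close> and \<open>y\<close>.\<close>
    obtain a where a: "a \<in> down x" using down_exists[of x] downD[OF x(1)] lev by auto
    then have a': "a \<in> down y" using down_pair_eq[OF z(1)] by simp
    have orth: "m a x * m x u + m a y * m y u = 0"
      if u: "x \<in> down u" "y \<in> down u" "down u = {x, y}" for u
    proof -
      have lev: "lev u = Suc (Suc (lev a))" using downD(3)[OF a] downD(3)[OF u(1)] by simp
      then have "a \<noteq> u" "\<not> adj a u" using lev_adj[of a u] by auto
      moreover have "{k. adj a k \<and> adj k u} = {x, y}"
        using down_between(1)[OF _ _ lev] u downD(2)[OF a] downD(2)[OF a'] downD(2)[OF u(1)]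
          downD(2)[OF u(2)] by blast
      ultimately show ?thesis
        using nonadjacent_sum[of a u] downD[OF a] downD[OF u(1)] assms(3) by simp
    qed
    have "{k. adj z k \<and> adj k z'} = {x, y}"
      using no x y downD by blast
    then have "m z x * m x z' + m z y * m y z' = 0"
      using nonadjacent_sum[of z z'] downD[OF x(1)] downD[OF x(2)] assms by simp
    then have zz: "m x z * m x z' + m y z * m y z' = 0"
      using m_sym downD[OF x(1)] downD[OF y(1)] by simp
    from orth[OF x(1) y(1) z(1)] orth[OF x(2) y(2) z(2)]
    have 1: "m a x * m x z = - (m a y * m y z)" "m a x * m x z' = - (m a y * m y z')" by linarith+
    \<comment> \<open>Multiplying the relations for \<open>z\<close> and \<open>z'\<close> makes the
      two products agree up to positive factors, whereas \<open>zz\<close> makes them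
      opposite.\<close>
    have "(m a x)\<^sup>2 * (m x z * m x z') = (m a x * m x z) * (m a x * m x z')"
      by (simp add: power2_eq_square)
    also have "\<dots> = (m a y)\<^sup>2 * (m y z * m y z')" unfolding 1 by (simp add: power2_eq_square)
    finally have 2: "(m a x)\<^sup>2 * (m x z * m x z') = (m a y)\<^sup>2 * (m y z * m y z')" .
    have "m x z * m x z' = - (m y z * m y z')" using zz by linarith
    with 2 have "((m a x)\<^sup>2 + (m a y)\<^sup>2) * (m y z * m y z') = 0" by (simp add: algebra_simps)
    moreover have "m y z * m y z' \<noteq> 0" "m a x \<noteq> 0"
      using m_nonzero downD(2)[OF y(1)] downD(2)[OF y(2)] downD(2)[OF a] by auto
    ultimately show False by (simp add: sum_power2_eq_zero_iff)
  qed
  with that show ?thesis by blast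
qed

end

section \<open>Minimal degree two\<close>

locale thin_rooted_graph = rooted_orthogonal_graph +
  assumes root_degree: "card (nbrs v) = 2"
    and card_down: "\<And>x. x < n \<Longrightarrow> 2 \<le> lev x \<Longrightarrow> card (down x) = 2"
    and card_S: "card S \<le> 1"
begin

lemma S_unique: "e \<in> S \<Longrightarrow> e' \<in> S \<Longrightarrow> e = e'"
  using card_S card_le_Suc0_iff_eq[OF finite_S] by auto

text \<open>A vertex \<open>b\<close> below \<open>p\<close> but not below \<open>q\<close> would
  need a second common neighbour with \<open>q\<close>, on the level of \<open>b\<close> or of
  \<open>q\<close>; that gives a second edge inside a level.\<close>

lemma S_down_eq:
  assumes "{p, q} \<in> S" shows "down p = down q"
proof -
  have "b \<in> down q" if pq: "{p, q} \<in> S" and b: "b \<in> down p" for p q b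
  proof (rule ccontr)
    assume nb: "b \<notin> down q"
    note lb = downD(3)[OF b] and lq = SD[OF pq]
    have "b \<noteq> q" "\<not> adj b q" using nb lb lq downI[of q b] adj_sym[of q b] by auto
    then obtain w where w: "w \<noteq> p" "adj b w" "adj w q"
      using other_common_neighbour[of b q p] downD(2)[OF b] lq(1) by blast
    have "lev w = lev q \<or> lev w = lev b"
      using lev_adj[OF w(2)] lev_adj[OF w(3)] lb lq(2) by linarith
    then have "{w, q} \<in> S \<or> {b, w} \<in> S" using w SI by metis
    then have "{w, q} = {p, q} \<or> {b, w} = {p, q}" using S_unique pq by blast
    with w(1) \<open>b \<noteq> q\<close> adjD(3)[OF w(3)] lb show False by (auto simp: doubleton_eq_iff)
  qed
  from this[of p q] this[of q p] assms show ?thesis by (auto simp: insert_commute)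
qed

text \<open>For distinct non-adjacent \<open>p\<close> and \<open>q\<close>, a second common
  neighbour \<open>w\<close> decides: below, it completes both pairs; beside, it costs two edges of
  \<open>S\<close>; above, \<open>down_pair_eq\<close> applies.\<close>

lemma down_meet_eq:
  assumes lev: "lev p = lev q" "2 \<le> lev p" and b: "b \<in> down p" "b \<in> down q"
  shows "down p = down q"
proof (cases "p = q \<or> {p, q} \<in> S")
  case True then show ?thesis using S_down_eq by auto
next
  case False
  then have "\<not> adj p q" using SI lev(1) by blast
  then obtain w where w: "w \<noteq> b" "adj p w" "adj w q"
    using other_common_neighbour[of p q b] False downD(1)[OF b(1)] downD(2)[OF b(2)] by blast
  have two: "card (down p) = 2" "card (down q) = 2"
    using card_down downD(4) b lev by auto
  show ?thesis
  proof (cases rule: two_path_level[OF w(2,3) lev(1)])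
    case 1
    have "{b, w} = down u" if "b \<in> down u" "w \<in> down u" "card (down u) = 2" for u
      using that w(1) by (intro card_subset_eq) auto
    from this[OF b(1) 1(1) two(1)] this[OF b(2) 1(2) two(2)] show ?thesis by simp
  next
    case 2
    then have "{p, w} = {q, w}" by (rule S_unique)
    with False show ?thesis by (auto simp: doubleton_eq_iff)
  next
    case 3
    then have "card (down w) = 2" using card_down[of w] downD[OF 3(1)] lev by simp
    then have "down w = {p, q}" using 3 False by (intro card_subset_eq[symmetric]) auto
    then show ?thesis by (rule down_pair_eq)
  qed
qed

text \<open>The planar argument forces a vertex above \<open>z1\<close> and \<open>z3\<close> and
  one above \<open>z2\<close> and \<open>z3\<close>. These share \<open>z3\<close>, so they would
  have the same lower pair. Whether \<open>z1\<close> and \<open>z2\<close> are adjacent is left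
  open, to allow for the one edge of \<open>S\<close>.\<close>

lemma three_not_thin:
  assumes d: "z1 \<noteq> z3" "z2 \<noteq> z3" "z1 \<noteq> z2" and na: "\<not> adj z1 z3" "\<not> adj z2 z3"
    and xy: "down z1 = {x, y}" "down z2 = {x, y}" "down z3 = {x, y}" "x \<noteq> y"
    and lev: "2 \<le> lev z1" "2 \<le> lev z2"
  shows False
proof -
  have "\<exists>f. down f = {z, z3} \<and> lev f = Suc (lev z3)"
    if z: "z \<noteq> z3" "\<not> adj z z3" "down z = {x, y}" "2 \<le> lev z" for z
  proof -
    have l: "lev z = lev z3" using downD(3)[of x z] downD(3)[of x z3] z xy by auto
    obtain w where w: "w \<notin> {x, y}" "adj z w" "adj w z3"
      using common_neighbour_outside_pair[of z x y z3] z xy by blast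
    show ?thesis
    proof (cases rule: two_path_level[OF w(2,3) l])
      case 1 with w(1) z(3) show ?thesis by simp
    next
      case 2
      then have "{z, w} = {z3, w}" by (rule S_unique)
      with z(1) show ?thesis by (auto simp: doubleton_eq_iff)
    next
      case 3
      then have "card (down w) = 2" using card_down[of w] downD[OF 3(1)] z(4) by simp
      then have "down w = {z, z3}" using 3 z(1) by (intro card_subset_eq[symmetric]) auto
      with downD(3)[OF 3(2)] show ?thesis by blast
    qed
  qed
  from this[of z1] this[of z2] d na xy lev
  obtain f g where fg: "down f = {z1, z3}" "down g = {z2, z3}" "lev f = lev g" "lev f = Suc (lev z3)"
    by metis
  have "lev z3 = lev z1" using downD(3)[of x z1] downD(3)[of x z3] xy by auto
  then have "down f = down g" using down_meet_eq[of f g z3] fg lev by simp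
  with fg d show False by (auto simp: doubleton_eq_iff)
qed

text \<open>Above a level of at most two vertices, every vertex is joined to that whole level, so
  three vertices would sit over the same pair.\<close>

lemma card_L_le_2: "card (L i) \<le> 2"
proof (induction i rule: less_induct)
  case (less i)
  consider "i = 0" | "i = 1" | k where "i = Suc k" "1 \<le> k" by (cases i rule: nat.exhaust) force+
  then show ?case
  proof cases
    case 1 then show ?thesis by (simp add: L_0)
  next
    case 2 then show ?thesis using root_degree by (simp add: L_1[simplified])
  next
    case 3
    show ?thesis
    proof (rule ccontr)
      assume "\<not> ?thesis"
      then have "3 \<le> card (L i)" by simp
      then obtain T where T: "T \<subseteq> L i" "card T = 3" using obtain_subset_with_card_n by metis
      then obtain z1 z2 z3 where z: "T = {z1, z2, z3}" "z1 \<noteq> z2" "z1 \<noteq> z3" "z2 \<noteq> z3"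
        by (auto simp: card_3_iff)
      have zl: "z < n \<and> lev z = i" if "z \<in> T" for z using that T by (auto simp: L_def)
      have dz: "down z = L k" if "z \<in> T" for z
      proof (rule card_seteq)
        show "down z \<subseteq> L k" using down_sub_L[of z] zl[OF that] 3 by simp
        show "card (L k) \<le> card (down z)"
          using less.IH[of k] card_down[of z] zl[OF that] 3 by simp
      qed simp
      then have "card (L k) = 2" using card_down[of z1] zl[of z1] 3 z(1) by auto
      then obtain x y where xy: "L k = {x, y}" "x \<noteq> y" by (auto simp: card_2_iff)
      have d: "down z1 = {x, y}" "down z2 = {x, y}" "down z3 = {x, y}"
        and l: "2 \<le> lev z1" "2 \<le> lev z2" "2 \<le> lev z3" and ll: "lev z1 = i" "lev z2 = i" "lev z3 = i"
        using dz xy zl z(1) 3 by auto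
      have S: "adj p q \<Longrightarrow> lev p = i \<Longrightarrow> lev q = i \<Longrightarrow> {p, q} \<in> S" for p q using SI by simp
      have "\<not> (adj z1 z2 \<and> adj z1 z3)" "\<not> (adj z1 z2 \<and> adj z2 z3)" "\<not> (adj z1 z3 \<and> adj z2 z3)"
        using S_unique[OF S S] ll z by (auto simp: doubleton_eq_iff)
      \<comment> \<open>With at most one edge among three vertices, one of them is adjacent to
        neither of the others.\<close>
      then consider "\<not> adj z1 z3" "\<not> adj z2 z3" | "\<not> adj z1 z2" "\<not> adj z3 z2" | "\<not> adj z2 z1" "\<not> adj z3 z1"
        using adj_sym by blast
      then show False
        using three_not_thin[of z1 z3 z2 x y] three_not_thin[of z1 z2 z3 x y]
          three_not_thin[of z2 z1 z3 x y] z d l xy(2) by cases auto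
    qed
  qed
qed

section \<open>Completeness between levels and the size of the last level\<close>

lemma card_L_eq_2:
  assumes "1 \<le> i" "L (Suc i) \<noteq> {}" shows "card (L i) = 2"
proof -
  obtain z where "z < n" "lev z = Suc i" using assms(2) by (auto simp: L_def)
  then have "card (down z) = 2" "down z \<subseteq> L i" using card_down assms(1) down_sub_L[of z] by auto
  then show ?thesis using card_mono[of "L i" "down z"] card_L_le_2[of i] by simp
qed

lemma consecutive_adjacent:
  assumes "x < n" "y < n" "lev y = Suc (lev x)" shows "adj x y"
proof (cases "lev x = 0")
  case True then show ?thesis using lev_1_adj[of y] lev_0D[of x] assms by simp
next
  case False
  then have "card (down y) = 2" using card_down assms by simp
  then have "down y = L (lev x)"
    using down_sub_L[of y] assms(3) card_L_le_2[of "lev x"] by (intro card_seteq) auto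
  then have "x \<in> down y" using assms by (simp add: L_def)
  then show ?thesis by (rule downD(2))
qed

definition height :: nat where "height = Max (lev ` {..<n})"

lemma lev_le_height: "x < n \<Longrightarrow> lev x \<le> height"
  unfolding height_def by (intro Max_ge) auto

lemma L_nonempty: assumes "i \<le> height" shows "L i \<noteq> {}"
proof -
  have "height \<in> lev ` {..<n}" unfolding height_def using v_less by (intro Max_in) auto
  then obtain x where "x < n" "lev x = height" by auto
  with lev_below[of x i] assms show ?thesis by (auto simp: L_def)
qed

lemma L_empty: "height < i \<Longrightarrow> L i = {}"
  using lev_le_height by (fastforce simp: L_def)

lemma height_pos: "1 \<le> height"
proof -
  obtain y where "adj v y" using adj_exists[OF v_less] .
  then have "y \<in> L 1" using L_1 by (auto simp: nbrs_def)
  then show ?thesis using L_empty[of 1] by (cases "height < 1") auto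
qed

lemma card_L_middle: "1 \<le> i \<Longrightarrow> i < height \<Longrightarrow> card (L i) = 2"
  using card_L_eq_2 L_nonempty[of "Suc i"] by simp

text \<open>One root, pairs in between and the last level; hence the parity of n decides whether the
  last level has one vertex or two.\<close>

lemma card_levels: "n + 1 = 2 * height + card (L height)"
proof -
  have "card {..<n} = (\<Sum>i\<le>height. card (L i))"
  proof -
    have "{..<n} = (\<Union>i\<le>height. L i)" using lev_le_height by (auto simp: L_def)
    moreover have "card (\<Union>i\<le>height. L i) = (\<Sum>i\<le>height. card (L i))"
      by (rule card_UN_disjoint) (auto simp: L_def)
    ultimately show ?thesis by simp
  qed
  also have "{..height} = insert height (insert 0 {1..<height})" using height_pos by auto
  also have "(\<Sum>i\<in>\<dots>. card (L i)) = card (L height) + (card (L 0) + (\<Sum>i\<in>{1..<height}. card (L i)))"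
    using height_pos by (subst sum.insert, simp, simp)+ simp
  also have "(\<Sum>i\<in>{1..<height}. card (L i)) = 2 * (height - 1)"
    using card_L_middle by simp
  finally show ?thesis using height_pos by (simp add: L_0)
qed

text \<open>Nothing lies above the last level, so non-adjacent \<open>x\<close> and \<open>y\<close>
  would have common neighbours only below: either just the root, against the common-neighbour rule,
  or just a pair, against the planar argument.\<close>

lemma top_pair_adjacent:
  assumes "L height = {x, y}" "x \<noteq> y" shows "adj x y"
proof (rule ccontr)
  assume na: "\<not> adj x y"
  have x: "x < n" "lev x = height" and y: "y < n" "lev y = height" using assms by (auto simp: L_def)
  have no_up: "u \<notin> down w" if "lev u = height" for u w
    using lev_le_height[of w] downD[of u w] that by auto
  obtain g where g: "g \<in> down x" using down_exists[of x] x height_pos by auto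
  have "g \<in> down y"
    using consecutive_adjacent[of g y] downD[OF g] x y adj_sym by (intro downI) auto
  note g = g this
  have only_down: "w \<in> down x" if w: "adj x w" "adj w y" for w
  proof (cases rule: two_path_level[OF w trans[OF x(2) y(2)[symmetric]]])
    case 2
    then have "{x, w} = {y, w}" by (rule S_unique)
    with assms(2) show ?thesis by (auto simp: doubleton_eq_iff)
  qed (use x y no_up in auto)
  show False
  proof (cases "height = 1")
    case True
    then have "down x = {v}" using down_lev_1[of x] x by simp
    then show False
      using other_common_neighbour[of x y g] only_down assms(2) na downD(1)[OF g(1)] downD(2)[OF g(2)] g
      by (metis singletonD)
  next
    case False
    then have h: "2 \<le> height" using height_pos by simp
    then have "card (down x) = 2" using card_down x by simp
    then obtain p q where pq: "down x = {p, q}" "p \<noteq> q" by (auto simp: card_2_iff)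
    then have "down y = {p, q}" using down_meet_eq[of x y g] g x y h by simp
    then show False
      using common_neighbour_outside_pair[of x p q y] pq assms(2) na only_down h x by metis
  qed
qed

end

section \<open>Minimal degree three\<close>

context rooted_orthogonal_graph
begin

definition heavy :: "nat set" where
  "heavy = {x. x < n \<and> 2 \<le> lev x \<and> card (down x) \<noteq> 2}"

lemma finite_heavy [simp]: "finite heavy"
  by (simp add: heavy_def)

lemma heavy_card: "x \<in> heavy \<Longrightarrow> 3 \<le> card (down x)"
  using card_down_ge_2[of x] by (auto simp: heavy_def)

lemma light: "x < n \<Longrightarrow> 2 \<le> lev x \<Longrightarrow> x \<notin> heavy \<Longrightarrow> card (down x) = 2"
  by (simp add: heavy_def)

lemma down_card_excess: "x < n \<Longrightarrow> 2 \<le> lev x \<Longrightarrow> card (down x) \<le> 2 + excess"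
  unfolding excess_def
  using member_le_sum[of x "{x. x < n \<and> 2 \<le> lev x}" "\<lambda>x. card (down x) - 2"] by simp

lemma card_heavy_le: "card heavy \<le> excess"
proof -
  have "card heavy = (\<Sum>x\<in>heavy. 1)" by simp
  also have "\<dots> \<le> (\<Sum>x\<in>heavy. card (down x) - 2)" using heavy_card by (intro sum_mono) fastforce
  also have "\<dots> \<le> excess" unfolding excess_def by (intro sum_mono2) (auto simp: heavy_def)
  finally show ?thesis .
qed

lemma card_S_ge_2: "e \<in> S \<Longrightarrow> e' \<in> S \<Longrightarrow> e \<noteq> e' \<Longrightarrow> 2 \<le> card S"
  using card_mono[of S "{e, e'}"] by simp

lemma card_S_ge_3:
  "e1 \<in> S \<Longrightarrow> e2 \<in> S \<Longrightarrow> e3 \<in> S \<Longrightarrow> e1 \<noteq> e2 \<Longrightarrow> e1 \<noteq> e3 \<Longrightarrow> e2 \<noteq> e3 \<Longrightarrow> 3 \<le> card S"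
  using card_mono[of S "{e1, e2, e3}"] by simp

lemma adj_down_L: "adj x y \<Longrightarrow> lev y = Suc (lev x) \<Longrightarrow> x \<in> down y"
  by (intro downI) (simp_all add: insert_commute)

end

text \<open>For d = 3 the count is 2n - 5 + s + t, so s + t is at most 1 for even n and at most 2
  for odd n. Odd n also has s at least 1, hence t is at most 1 in every case: at most one heavy
  vertex, with exactly three downward edges.\<close>

locale cubic_rooted_graph = rooted_orthogonal_graph +
  assumes root_degree: "card (nbrs v) = 3"
    and min_degree: "\<And>x. x < n \<Longrightarrow> 3 \<le> card (nbrs x)"
    and heavy_3: "\<And>x. x \<in> heavy \<Longrightarrow> card (down x) = 3"
    and heavy_unique: "\<And>x y. x \<in> heavy \<Longrightarrow> y \<in> heavy \<Longrightarrow> x = y"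
    and budget: "card S + card heavy \<le> 2"
    and parity_budget: "odd n \<or> card S + card heavy \<le> 1"
begin

section \<open>How the budget for edges inside levels and heavy vertices is spent\<close>

lemma third_neighbour: assumes "x < n" obtains y where "adj x y" "y \<noteq> u" "y \<noteq> w"
proof -
  have "\<not> nbrs x \<subseteq> {u, w}"
  proof
    assume "nbrs x \<subseteq> {u, w}"
    then have "card (nbrs x) \<le> card {u, w}" by (intro card_mono) auto
    also have "\<dots> \<le> 2" by (simp add: card_insert_if)
    finally show False using min_degree[OF assms] by simp
  qed
  with that show ?thesis by (auto simp: nbrs_def)
qed

lemma heavy_budget: "x \<in> heavy \<Longrightarrow> card heavy = 1"
  using heavy_unique by (metis card_1_singletonE is_singletonI' is_singleton_altdef empty_iff)

lemma heavy_empty: assumes "2 \<le> card S" shows "heavy = {}"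
proof -
  have "card heavy = 0" using budget assms by linarith
  then show ?thesis by simp
qed

lemma down_lev_2: "lev x = 2 \<Longrightarrow> down x \<subseteq> nbrs v"
  using down_sub_L[of x] L_1 by simp

lemma top_vertex:
  assumes "x < n" "2 \<le> lev x" "\<And>w. x \<notin> down w"
  shows "x \<in> heavy \<or> (\<exists>w. {x, w} \<in> S)"
proof (rule ccontr)
  assume no: "\<not> ?thesis"
  then have "card (down x) = 2" using light assms by blast
  moreover have "nbrs x \<subseteq> down x" using adj_cases no assms(3) by (auto simp: nbrs_def)
  then have "card (nbrs x) \<le> card (down x)" by (intro card_mono) auto
  ultimately show False using min_degree[OF assms(1)] by simp
qed

lemma max_level_vertex:
  assumes "x < n" obtains z where "z < n" "lev x \<le> lev z" "\<And>w. w < n \<Longrightarrow> lev w \<le> lev z"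
proof -
  have "Max (lev ` {..<n}) \<in> lev ` {..<n}" using assms by (intro Max_in) auto
  then obtain z where z: "z < n" "lev z = Max (lev ` {..<n})" by auto
  then have "lev w \<le> lev z" if "w < n" for w using that by simp
  with z assms that show ?thesis by blast
qed

lemma no_up_max: "(\<And>w. w < n \<Longrightarrow> lev w \<le> lev z) \<Longrightarrow> z \<notin> down w"
  using downD[of z w] by fastforce

text \<open>With only two lower neighbours, \<open>w\<close> would force
  \<open>down p = down q\<close> by \<open>down_pair_eq\<close>.\<close>

lemma meet_light_up:
  assumes p: "card (down p) = 2" "card (down q) = 2" "down p \<noteq> down q"
    and w: "p \<in> down w" "q \<in> down w" and lev: "2 \<le> lev p"
  shows "w \<in> heavy"
proof (rule ccontr)
  assume "w \<notin> heavy"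
  then have "card (down w) = 2" using light downD[OF w(1)] lev by simp
  moreover have "p \<noteq> q" using p(3) by auto
  ultimately have "down w = {p, q}" using w by (intro card_subset_eq[symmetric]) auto
  then have "down p = down q" by (rule down_pair_eq)
  with p show False by simp
qed

lemma card_n_levels:
  assumes "\<And>x. x < n \<Longrightarrow> lev x \<le> 3"
  shows "n = 4 + card (L 2) + card (L 3)"
proof -
  have "{..<n} = L 0 \<union> (L 1 \<union> (L 2 \<union> L 3))"
  proof -
    have "x \<in> L 0 \<union> (L 1 \<union> (L 2 \<union> L 3))" if "x < n" for x
    proof -
      have "lev x = 0 \<or> lev x = 1 \<or> lev x = 2 \<or> lev x = 3" using assms[OF that] by linarith
      with that show ?thesis unfolding L_def by blast
    qed
    moreover have "L 0 \<union> (L 1 \<union> (L 2 \<union> L 3)) \<subseteq> {..<n}" by (auto simp: L_def)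
    ultimately show ?thesis by blast
  qed
  then have "card {..<n} = card (L 0 \<union> (L 1 \<union> (L 2 \<union> L 3)))" by simp
  also have "\<dots> = card (L 0) + (card (L 1) + (card (L 2) + card (L 3)))"
  proof -
    have "L i \<inter> L j = {}" if "i \<noteq> j" for i j using that by (auto simp: L_def)
    then show ?thesis by (simp add: card_Un_disjoint Int_Un_distrib)
  qed
  finally show ?thesis using L_0 L_1 root_degree by simp
qed

text \<open>Two edges exhaust the budget. A vertex of maximal level at least 2 would need a third
  edge inside a level, so levels stop at 1; but then the third neighbour of \<open>a\<close> also
  yields a third such edge.\<close>

lemma L1_two_edges:
  assumes d: "a \<noteq> c" and ab: "adj b a" "adj b c" and lev: "lev a = 1" "lev b = 1" "lev c = 1"
  shows False
proof -
  note n = adjD[OF ab(1)] adjD[OF ab(2)]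
  have S: "{b, a} \<in> S" "{b, c} \<in> S" "{b, a} \<noteq> {b, c}" using ab lev d SI by (auto simp: doubleton_eq_iff)
  then have "2 \<le> card S" by (rule card_S_ge_2)
  then have B: "heavy = {}" by (rule heavy_empty)
  have low: "lev x \<le> 1" if x: "x < n" for x
  proof (rule ccontr)
    assume "\<not> lev x \<le> 1"
    obtain z where z: "z < n" "lev x \<le> lev z" "\<And>w. w < n \<Longrightarrow> lev w \<le> lev z"
      using max_level_vertex[OF x] by blast
    have z2: "2 \<le> lev z" using z(2) \<open>\<not> lev x \<le> 1\<close> by simp
    obtain w where w: "{z, w} \<in> S" using top_vertex[OF z(1) z2 no_up_max] z(3) B by auto
    have "{z, w} \<noteq> {b, a}" "{z, w} \<noteq> {b, c}" using z2 lev by (auto simp: doubleton_eq_iff)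
    then have "3 \<le> card S" using card_S_ge_3[OF S(1,2) w] S(3) by auto
    with budget show False by simp
  qed
  obtain y where y: "adj a y" "y \<noteq> v" "y \<noteq> b" using third_neighbour[OF n(2)] by blast
  have "lev y = 1" using low[OF adjD(2)[OF y(1)]] lev_0D[OF adjD(2)[OF y(1)]] y(2) by linarith
  then have "{a, y} \<in> S" using y lev SI by simp
  moreover have "{a, y} \<noteq> {b, a}" "{a, y} \<noteq> {b, c}" using y d n by (auto simp: doubleton_eq_iff)
  ultimately have "3 \<le> card S" using card_S_ge_3[OF S(1,2)] S(3) by auto
  with budget show False by simp
qed

text \<open>The edge from \<open>a\<close> to \<open>b\<close> leaves at most one unit of budget.
  Spending it on a second edge leads to n = 6, spending it on a heavy vertex to n = 8 or to degree
  two at \<open>c\<close>; yet spending both units requires odd n.\<close>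

lemma L1_one_edge:
  assumes N: "nbrs v = {a, b, c}" and d: "a \<noteq> b" "a \<noteq> c" "b \<noteq> c" and ab: "adj a b"
  shows False
proof -
  have lev1: "lev a = 1" "lev b = 1" "lev c = 1" and less: "a < n" "b < n" "c < n"
    using N L_1 by (auto simp: L_def)
  have na: "\<not> adj a c" "\<not> adj b c"
    using L1_two_edges[of b c a] L1_two_edges[of a c b] ab d lev1 adj_sym by blast+
  have S: "{a, b} \<in> S" using SI ab lev1 by simp
  \<comment> \<open>The root cannot be the only common neighbour of \<open>a'\<close> and
    \<open>c\<close>, and no other one can lie on level 1.\<close>
  have corner: "\<exists>x. x < n \<and> lev x = 2 \<and> a' \<in> down x \<and> c \<in> down x"
    if a': "a' \<in> {a, b}" for a'
  proof -
    have "\<not> adj a' c" "a' \<noteq> c" "adj a' v" "adj v c"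
      using a' na d N by (auto simp: nbrs_def insert_commute)
    then obtain x where x: "x \<noteq> v" "adj a' x" "adj x c" using other_common_neighbour by blast
    have "lev x \<noteq> 0" using x(1) lev_0D adjD[OF x(2)] by blast
    moreover have "lev x \<noteq> 1"
    proof
      assume "lev x = 1"
      then have "x \<in> {a, b, c}" using N L_1 adjD(2)[OF x(2)] by (auto simp: L_def)
      then show False using x na adjD(3)[OF x(3)] by auto
    qed
    moreover have "lev x \<le> 2" using lev_adj[OF x(2)] a' lev1 by auto
    ultimately have "lev x = 2" by linarith
    then show ?thesis using x a' lev1 adjD[OF x(2)] adj_sym[of x c] by (auto intro!: adj_down_L exI[of _ x])
  qed
  obtain x where x: "x < n" "lev x = 2" "a \<in> down x" "c \<in> down x" using corner[of a] by auto
  obtain y where y: "y < n" "lev y = 2" "b \<in> down y" "c \<in> down y" using corner[of b] by auto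
  obtain z where z: "z < n" "2 \<le> lev z" "\<And>w. w < n \<Longrightarrow> lev w \<le> lev z"
    using max_level_vertex[OF x(1)] x(2) by auto
  have S1: "{u, w} \<noteq> {a, b}" if "2 \<le> lev u" for u w using that lev1 by (auto simp: doubleton_eq_iff)
  show False
  proof (cases "heavy = {}")
    case True
    then have two: "card (down u) = 2" if "u < n" "2 \<le> lev u" for u using light that by blast
    have dx: "{a, c} = down x" "{b, c} = down y"
      using x y d two[of x] two[of y] by (intro card_subset_eq; simp)+
    then have ne: "down x \<noteq> down y" "x \<noteq> y" using d by (auto simp: doubleton_eq_iff)
    have "adj x y"
    proof (rule ccontr)
      assume "\<not> adj x y"
      then obtain w where w: "w \<noteq> c" "adj x w" "adj w y"
        using other_common_neighbour[of x y c] ne(2) downD(1)[OF x(4)] downD(2)[OF y(4)] by blast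
      show False
      proof (cases rule: two_path_level[OF w(2,3) trans[OF x(2) y(2)[symmetric]]])
        case 1 then show False using w(1) d unfolding dx[symmetric] by auto
      next
        case 2
        moreover have "{x, w} \<noteq> {y, w}" using ne by (auto simp: doubleton_eq_iff)
        ultimately have "3 \<le> card S"
          using card_S_ge_3[OF S 2] S1[of x w] S1[of y w] x(2) y(2) by simp
        with budget show False by simp
      next
        case 3
        then have "w \<in> heavy" using meet_light_up[of x y w] two ne x y by simp
        with True show False by simp
      qed
    qed
    then have xy: "{x, y} \<in> S" using SI x y by simp
    have S2: "2 \<le> card S" using card_S_ge_2[OF S xy] S1[of x y] x(2) by auto
    \<comment> \<open>The edges from \<open>a\<close> to \<open>b\<close> and from \<open>x\<close>
      to \<open>y\<close> are now all of \<open>S\<close>, and a vertex with nothing above it must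
      lie on one of them.\<close>
    have top: "u = x \<or> u = y" if u: "u < n" "2 \<le> lev u" "\<And>w. u \<notin> down w" for u
    proof -
      obtain w where w: "{u, w} \<in> S" using top_vertex[OF u] True by auto
      have "{u, w} = {x, y}"
      proof (rule ccontr)
        assume "{u, w} \<noteq> {x, y}"
        then have "3 \<le> card S" using card_S_ge_3[OF S xy w] S1[of x y] S1[of u w] x(2) u(2) by auto
        with budget show False by simp
      qed
      then show ?thesis by (auto simp: doubleton_eq_iff)
    qed
    have "lev z = 2" using top[OF z(1,2) no_up_max] z(3) x y by auto
    then have le2: "lev u \<le> 2" if "u < n" for u using z(3) that by simp
    have "u \<notin> down w" if "lev u = 2" for u w using downD(3)[of u w] downD(4)[of u w] le2[of w] that by auto
    then have "u = x \<or> u = y" if "u < n" "lev u = 2" for u using top[of u] that by simp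
    then have "L 2 = {x, y}" using x y by (auto simp: L_def)
    moreover have "L 3 = {}" using le2 by (fastforce simp: L_def)
    moreover have "lev u \<le> 3" if "u < n" for u using le2[OF that] by simp
    ultimately have "n = 6" using card_n_levels ne by simp
    with parity_budget S2 show False by simp
  next
    case False
    then obtain h where h: "h \<in> heavy" by blast
    have h1: "card heavy = 1" using heavy_budget[OF h] .
    have "card S > 0" using S by (auto simp: card_gt_0_iff)
    then have even: "card S = 1" "odd n" using budget parity_budget h1 by linarith+
    have S_eq: "e = {a, b}" if "e \<in> S" for e
      using card_S_ge_2[OF that S] even by auto
    have top: "u = h" if u: "u < n" "2 \<le> lev u" "\<And>w. u \<notin> down w" for u
      using top_vertex[OF u] S_eq S1[OF u(2)] heavy_unique h by blast
    have "z = h" using top[OF z(1,2) no_up_max] z(3) by auto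
    note z = z[unfolded this]
    have two: "card (down u) = 2" if "u < n" "2 \<le> lev u" "u \<noteq> h" for u
      using light that heavy_unique h by blast
    show False
    proof (cases "lev h = 2")
      case True
      have only: "u = h" if "lev u = 2" "u < n" for u
      proof (rule top)
        show "u \<notin> down w" for w using downD(3)[of u w] downD(4)[of u w] z(3)[of w] True that by auto
      qed (use that in auto)
      \<comment> \<open>With \<open>h\<close> alone on level 2, only \<open>v\<close> and
        \<open>h\<close> remain as neighbours of \<open>c\<close>.\<close>
      obtain u where u: "adj c u" "u \<noteq> v" "u \<noteq> h" using third_neighbour[OF less(3)] by blast
      have "lev u \<noteq> 0" using u(2) lev_0D adjD[OF u(1)] by blast
      moreover have "lev u \<noteq> 1"
      proof
        assume "lev u = 1"
        then have "{c, u} \<in> S" using SI[OF u(1)] lev1 by simp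
        from S_eq[OF this] show False using d by (auto simp: doubleton_eq_iff)
      qed
      moreover have "lev u \<le> 2" using lev_adj[OF u(1)] lev1 by simp
      ultimately have "lev u = 2" by linarith
      with only[of u] u adjD[OF u(1)] show False by simp
    next
      case False
      then have h3: "3 \<le> lev h" using z(2) by simp
      have dx: "{a, c} = down x" "{b, c} = down y"
      proof -
        have "x \<noteq> h" "y \<noteq> h" using x y False by auto
        then show "{a, c} = down x" "{b, c} = down y"
          using x y d two[of x] two[of y] by (intro card_subset_eq; simp)+
      qed
      then have ne: "down x \<noteq> down y" "x \<noteq> y" using d by (auto simp: doubleton_eq_iff)
      have "\<not> adj x y" using SI[of x y] S_eq S1[of x y] x y by auto
      then obtain w where w: "w \<noteq> c" "adj x w" "adj w y"
        using other_common_neighbour[of x y c] ne(2) downD(1)[OF x(4)] downD(2)[OF y(4)] by blast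
      \<comment> \<open>The second common neighbour of \<open>x\<close> and \<open>y\<close> cannot
        lie below or beside them; above them it is heavy, hence \<open>h\<close>.\<close>
      have "x \<in> down h"
      proof (cases rule: two_path_level[OF w(2,3) trans[OF x(2) y(2)[symmetric]]])
        case 1 then show ?thesis using w(1) d unfolding dx[symmetric] by auto
      next
        case 2
        with S_eq[OF 2(1)] S1[of x w] x(2) show ?thesis by simp
      next
        case 3
        then have "w \<in> heavy"
          using meet_light_up[of x y w] two[of x] two[of y] ne x y False by fastforce
        with 3 heavy_unique h show ?thesis by blast
      qed
      then have h3: "lev h = 3" using downD(3) x(2) by fastforce
      have le3: "lev u \<le> 3" if "u < n" for u using z(3) that h3 by simp
      have "u = h" if u: "u < n" "lev u = 3" for u
      proof -
        have "u \<notin> down w" for w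
        proof
          assume "u \<in> down w"
          then show False using downD(3,4)[of u w] le3[of w] u by simp
        qed
        with top[of u] u show ?thesis by simp
      qed
      then have L3: "L 3 = {h}" using h3 z(1) unfolding L_def by blast
      have "u \<in> down h" if u: "u < n" "lev u = 2" for u
      proof (rule ccontr)
        assume "u \<notin> down h"
        have "u \<notin> down w" for w
        proof
          assume u': "u \<in> down w"
          then have "w \<in> L 3" using downD(3,4)[of u w] u by (simp add: L_def)
          with L3 u' \<open>u \<notin> down h\<close> show False by simp
        qed
        then have "u = h" using top[of u] u by simp
        with u h3 show False by simp
      qed
      then have "L 2 = down h" using down_sub_L[of h] h3 by (auto simp: L_def)
      then have "n = 8" using card_n_levels[OF le3] L3 heavy_3[OF h] by simp
      with even show False by simp
    qed
  qed
qed

lemma L1_independent: assumes "lev x = 1" "lev y = 1" shows "\<not> adj x y"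
proof
  assume a: "adj x y"
  note xy = adjD[OF a]
  have mem: "x \<in> nbrs v" "y \<in> nbrs v" using assms xy L_1 by (auto simp: L_def)
  have "card (nbrs v - {x, y}) = 1" using mem xy root_degree by (simp add: card_Diff_subset)
  then obtain c where c: "nbrs v - {x, y} = {c}" by (auto simp: card_1_singleton_iff)
  then have "nbrs v = {x, y, c}" "x \<noteq> c" "y \<noteq> c" using mem by auto
  with L1_one_edge[of x y c] xy a show False by simp
qed

text \<open>Since level 1 is independent, \<open>b\<close> forces a further edge inside level 2 at
  \<open>q\<close>, and \<open>c\<close> one at \<open>p\<close>; with the edge between
  \<open>p\<close> and \<open>q\<close> that makes three.\<close>

lemma L2_adjacent_nested:
  assumes pq: "{p, q} \<in> S" "lev p = 2" and b: "b \<in> down p" "b \<notin> down q" and c: "c \<in> down q" "c \<notin> down p"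
  shows False
proof -
  have "\<exists>w. w \<noteq> p \<and> {w, q} \<in> S"
    if pq: "{p, q} \<in> S" "lev p = 2" and b: "b \<in> down p" "b \<notin> down q" for p q b
  proof -
    have lb: "lev b = 1" using downD(3)[OF b(1)] pq(2) by simp
    have lq: "lev q = 2" using SD[OF pq(1)] pq(2) by simp
    have "b \<noteq> q" "\<not> adj b q" using b(2) lb lq adj_down_L[of b q] by auto
    then obtain w where w: "w \<noteq> p" "adj b w" "adj w q"
      using other_common_neighbour[of b q p] downD(2)[OF b(1)] SD(1)[OF pq(1)] by blast
    have "lev w \<noteq> 1" using L1_independent[OF lb] w by blast
    then have "lev w = 2" using lev_adj[OF w(2)] lev_adj[OF w(3)] lb lq by linarith
    with w lq SI show ?thesis by (intro exI[of _ w]) simp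
  qed
  note ex = this
  obtain w where w: "w \<noteq> p" "{w, q} \<in> S" using ex[OF pq b] by blast
  have qp: "{q, p} \<in> S" "lev q = 2" using pq SD[OF pq(1)] by (auto simp: insert_commute)
  obtain u where u: "u \<noteq> q" "{u, p} \<in> S" using ex[OF qp c] by blast
  have "p \<noteq> q" using SD(1)[OF pq(1)] adjD(3) by blast
  then have "3 \<le> card S"
    using w u by (intro card_S_ge_3[OF pq(1) w(2) u(2)]) (auto simp: doubleton_eq_iff)
  with budget show False by simp
qed

lemma pair_diff:
  assumes "card A = 2" "card (B :: nat set) = 2" "A \<noteq> B" obtains b where "b \<in> A" "b \<notin> B"
proof -
  have "finite B" using assms(2) by (intro card_ge_0_finite) simp
  then have "\<not> A \<subseteq> B" using assms card_subset_eq[of B A] by auto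
  with that show ?thesis by blast
qed

lemma L2_adjacent_eq:
  assumes "{p, q} \<in> S" "lev p = 2" "card (down p) = 2" "card (down q) = 2"
  shows "down p = down q"
  using L2_adjacent_nested[OF assms(1,2)] pair_diff[of "down p" "down q"]
    pair_diff[of "down q" "down p"] assms(3,4) by metis

text \<open>Two pairs inside the three neighbours of \<open>v\<close> meet. A second common
  neighbour of \<open>p\<close> and \<open>q\<close> lying below or beside them would make the pairs
  equal, so it lies above both and is heavy.\<close>

lemma L2_pair_up:
  assumes lev: "lev p = 2" "lev q = 2" and two: "card (down p) = 2" "card (down q) = 2"
    and ne: "down p \<noteq> down q"
  obtains h where "h \<in> heavy" "p \<in> down h" "q \<in> down h"
proof -
  have pq: "p \<noteq> q" using ne by auto
  have "card (down p \<union> down q) \<le> 3"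
    using card_mono[of "nbrs v" "down p \<union> down q"] down_lev_2 lev root_degree by simp
  then have "down p \<inter> down q \<noteq> {}" using card_Un_Int[of "down p" "down q"] two by auto
  then obtain b where b: "b \<in> down p" "b \<in> down q" by blast
  have "\<not> adj p q" using L2_adjacent_eq[of p q] SI[of p q] lev two ne by auto
  then obtain w where w: "w \<noteq> b" "adj p w" "adj w q"
    using other_common_neighbour[of p q b] pq downD(1)[OF b(1)] downD(2)[OF b(2)] by blast
  show ?thesis
  proof (cases rule: two_path_level[OF w(2,3) trans[OF lev(1) lev(2)[symmetric]]])
    case 1
    have "{b, w} = down u" if "b \<in> down u" "w \<in> down u" "card (down u) = 2" for u
      using that w(1) by (intro card_subset_eq) auto
    from this[OF b(1) 1(1) two(1)] this[OF b(2) 1(2) two(2)] ne show ?thesis by simp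
  next
    case 2
    have "{p, w} \<noteq> {q, w}" using pq by (auto simp: doubleton_eq_iff)
    then have "2 \<le> card S" using card_S_ge_2[OF 2] by simp
    then have "heavy = {}" by (rule heavy_empty)
    moreover have "lev w = 2" "w < n" using SD(2)[OF 2(1)] adjD[OF w(2)] lev by auto
    ultimately have "card (down w) = 2" using light by simp
    then have "down p = down w" "down q = down w" using L2_adjacent_eq 2 lev two by blast+
    with ne show ?thesis by simp
  next
    case 3
    then have "w \<in> heavy" using meet_light_up[OF two ne] lev by simp
    with that 3 show ?thesis by blast
  qed
qed

lemma lev_1_up:
  assumes "x < n" "lev x = 1" obtains y where "lev y = 2" "x \<in> down y" "y \<noteq> u" "y < n"
proof -
  obtain y where y: "adj x y" "y \<noteq> v" "y \<noteq> u" using third_neighbour[OF assms(1)] by blast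
  have "lev y \<noteq> 0" "lev y \<noteq> 1"
    using lev_0D[of y] adjD[OF y(1)] y(1,2) L1_independent[OF assms(2), of y] by auto
  then have "lev y = 2" using lev_adj[OF y(1)] assms by linarith
  with that[of y] y assms adj_down_L[of x y] adjD[OF y(1)] show ?thesis by simp
qed

text \<open>Every neighbour of \<open>v\<close> has a level 2 neighbour other than \<open>x\<close>,
  which yields two light vertices there with different lower pairs. The heavy vertex lies above them
  by \<open>L2_pair_up\<close>, so it cannot be \<open>x\<close>.\<close>

lemma lev_2_light: assumes "lev x = 2" "x < n" shows "card (down x) = 2"
proof (rule ccontr)
  assume "card (down x) \<noteq> 2"
  then have x: "x \<in> heavy" using assms by (simp add: heavy_def)
  have two: "card (down y) = 2" if "y < n" "lev y = 2" "y \<noteq> x" for y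
    using light heavy_unique x that by (metis order_refl)
  obtain a where a: "a \<in> down x" using down_exists[of x] assms by auto
  then have "a < n" "lev a = 1" using downD[OF a] assms by auto
  then obtain y where y: "lev y = 2" "y \<noteq> x" "y < n" using lev_1_up[of a x] by blast
  have "\<not> nbrs v \<subseteq> down y" using card_mono[of "down y" "nbrs v"] two y root_degree by force
  then obtain c where c: "c \<in> nbrs v" "c \<notin> down y" by blast
  then have "c < n" "lev c = 1" using L_1 by (auto simp: L_def)
  then obtain z where z: "lev z = 2" "c \<in> down z" "z \<noteq> x" "z < n" using lev_1_up[of c x] by blast
  then have ne: "down y \<noteq> down z" using c by auto
  obtain h where "h \<in> heavy" "y \<in> down h"
    using L2_pair_up[OF y(1) z(1) two[OF y(3,1,2)] two[OF z(4,1,3)] ne] .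
  then have "y \<in> down x" using heavy_unique[OF x] by simp
  then show False using downD(3)[of y x] y assms by simp
qed

text \<open>Each pair in level 1 is the lower pair of a level 2 vertex, and different lower pairs
  force the heavy vertex above. A light vertex on level 3 would need two level 2 vertices with equal
  lower pairs, and a vertex on level 4 would find only \<open>h\<close> below it.\<close>

lemma cube_structure:
  obtains a b c p q r h where
    "nbrs v = {a, b, c}" "a \<noteq> b" "a \<noteq> c" "b \<noteq> c"
    "down p = {a, b}" "down q = {a, c}" "down r = {b, c}" "down h = {p, q, r}"
    "L 2 = {p, q, r}" "L 3 = {h}" "\<And>x. x < n \<Longrightarrow> lev x \<le> 3" "S = {}" "n = 8"
proof -
  obtain a b c where N: "nbrs v = {a, b, c}" and d: "a \<noteq> b" "a \<noteq> c" "b \<noteq> c"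
    using root_degree by (auto simp: card_3_iff)
  have lev1: "lev x = 1" "x < n" if "x \<in> {a, b, c}" for x using N L_1 that by (auto simp: L_def)
  have pair: "\<exists>w. w < n \<and> lev w = 2 \<and> down w = {x, y}"
    if x: "x \<in> {a, b, c}" and y: "y \<in> {a, b, c}" and ne: "x \<noteq> y" for x y
  proof -
    have "\<not> adj x y" using L1_independent lev1 x y by simp
    moreover have "adj x v" "adj v y" using x y N by (auto simp: nbrs_def insert_commute)
    ultimately obtain w where w: "w \<noteq> v" "adj x w" "adj w y"
      using other_common_neighbour[of x y v] ne by blast
    have "lev w \<noteq> 0" "lev w \<noteq> 1"
      using lev_0D[of w] adjD[OF w(2)] w L1_independent[of x w] lev1[OF x] by auto
    then have lw: "lev w = 2" using lev_adj[OF w(2)] lev1[OF x] by linarith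
    then have "{x, y} \<subseteq> down w" using w lev1 x y by (auto intro!: downI simp: insert_commute)
    moreover have "card (down w) = 2" using lev_2_light lw adjD[OF w(2)] by simp
    ultimately have "{x, y} = down w" using ne by (intro card_subset_eq) auto
    with lw adjD[OF w(2)] show ?thesis by auto
  qed
  obtain p where p: "p < n" "lev p = 2" "down p = {a, b}" using pair[of a b] d by auto
  obtain q where q: "q < n" "lev q = 2" "down q = {a, c}" using pair[of a c] d by auto
  obtain r where r: "r < n" "lev r = 2" "down r = {b, c}" using pair[of b c] d by auto
  have dne: "down p \<noteq> down q" "down p \<noteq> down r" "down q \<noteq> down r"
    using p q r d by (auto simp: doubleton_eq_iff)
  then have ne: "p \<noteq> q" "p \<noteq> r" "q \<noteq> r" by auto
  note two = lev_2_light
  obtain h where h: "h \<in> heavy" "p \<in> down h" "q \<in> down h"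
    using L2_pair_up[of p q] p q two dne by metis
  \<comment> \<open>At least one of \<open>p\<close> and \<open>q\<close> has a lower pair different
    from that of \<open>x\<close>.\<close>
  have up: "x \<in> down h" if x: "x < n" "lev x = 2" for x
  proof -
    obtain y where y: "lev y = 2" "y < n" "down y \<noteq> down x" using p q dne by metis
    obtain h' where "h' \<in> heavy" "x \<in> down h'" using L2_pair_up[of x y] x y two by metis
    with h heavy_unique show ?thesis by blast
  qed
  have lh: "lev h = 3" "h < n" using downD[OF h(2)] p by auto
  have dh: "down h = {p, q, r}"
    using up[of r] r h ne heavy_3[OF h(1)] by (intro card_subset_eq[symmetric]) auto
  have L2: "L 2 = {p, q, r}" using up dh p q r by (auto simp: L_def)
  have L3: "L 3 = {h}"
  proof -
    have "x = h" if x: "x < n" "lev x = 3" for x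
    proof (rule ccontr)
      assume "x \<noteq> h"
      then have "card (down x) = 2" using light[of x] heavy_unique h x by fastforce
      then obtain g g' where g: "down x = {g, g'}" "g \<noteq> g'" by (auto simp: card_2_iff)
      then have "down g = down g'" by (intro down_pair_eq)
      moreover have "{g, g'} \<subseteq> {p, q, r}" using down_sub_L[of x] x L2 g by simp
      ultimately show False using g(2) dne by auto
    qed
    then show ?thesis using lh unfolding L_def by blast
  qed
  have le3: "lev x \<le> 3" if x: "x < n" for x
  proof (rule ccontr)
    assume "\<not> ?thesis"
    then obtain y where y: "y < n" "lev y = 4" using lev_below[OF x, of 4] by auto
    then have "down y \<subseteq> {h}" using down_sub_L[of y] L3 by simp
    then have "card (down y) \<le> 1" using card_mono[of "{h}" "down y"] by simp
    with card_down_ge_2[of y] y show False by simp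
  qed
  have n: "n = 8" using card_n_levels[OF le3] L2 L3 ne by simp
  \<comment> \<open>As n = 8 is even, the heavy vertex \<open>h\<close> uses up the whole
    budget.\<close>
  then have "card S = 0" using parity_budget heavy_budget[OF h(1)] by simp
  then have "S = {}" by simp
  from that[OF N d p(3) q(3) r(3) dh L2 L3 le3 this n] show ?thesis .
qed

end

section \<open>Classification\<close>

context thin_rooted_graph
begin

lemma card_L: "card (L i) =
  (if i = 0 then 1 else if i < height then 2 else if i = height then card (L height) else 0)"
  using L_0 card_L_middle[of i] L_empty[of i] by auto

lemma level_bij:
  assumes fin: "finite W" and card: "\<And>i. card {y \<in> W. y div 2 = i} = card (L i)"
  obtains f where "bij_betw f {0..<n} W" "\<And>x. x < n \<Longrightarrow> f x div 2 = lev x"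
proof -
  have "card {x \<in> {0..<n}. lev x = i} = card {y \<in> W. y div 2 = i}" for i
    unfolding card L_def by simp
  then obtain f where "bij_betw f {0..<n} W" "\<And>x. x \<in> {0..<n} \<Longrightarrow> f x div 2 = lev x"
    using bij_betw_fibres[of "{0..<n}" W lev "\<lambda>y. y div 2"] fin by blast
  with that show ?thesis by auto
qed

lemma adj_iff_lev:
  assumes "u < n" "w < n"
  shows "adj u w \<longleftrightarrow> lev w = lev u + 1 \<or> lev u = lev w + 1 \<or> {u, w} \<in> S"
proof
  assume "adj u w"
  then show "lev w = lev u + 1 \<or> lev u = lev w + 1 \<or> {u, w} \<in> S"
    using adj_cases downD(3) by fastforce
next
  assume "lev w = lev u + 1 \<or> lev u = lev w + 1 \<or> {u, w} \<in> S"
  then show "adj u w"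
    using consecutive_adjacent[of u w] consecutive_adjacent[of w u] assms SD(1) adj_sym[of u w] by auto
qed

lemma L_height_cases: "card (L height) = 1 \<or> card (L height) = 2"
proof -
  have "card (L height) \<noteq> 0" using L_nonempty[of height] by simp
  with card_L_le_2[of height] show ?thesis by linarith
qed

lemma iso_candle:
  assumes "even n" "S = {}"
  shows "\<exists>k\<ge>2. n = 2 * k \<and> graph_iso {0..<n} E (candle_V k) (candle_E k)"
proof -
  have top: "card (L height) = 1" using L_height_cases card_levels assms(1) by presburger
  then have n: "n = 2 * height" using card_levels by simp
  have h2: "2 \<le> height" using n n_ge_3 by simp
  have "card {y \<in> candle_V height. y div 2 = i} = card (L i)" for i
    unfolding candle_V_def card_candle_level using card_L[of i] top height_pos by simp
  then obtain f where f: "bij_betw f {0..<n} (candle_V height)" "\<And>x. x < n \<Longrightarrow> f x div 2 = lev x"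
    using level_bij[of "candle_V height"] by (auto simp: candle_V_def)
  have "adj u w \<longleftrightarrow> {f u, f w} \<in> candle_E height" if "u \<in> {0..<n}" "w \<in> {0..<n}" for u w
  proof -
    have "f u \<in> {1..2 * height}" "f w \<in> {1..2 * height}"
      using bij_betw_apply[OF f(1)] that unfolding candle_V_def by blast+
    then show ?thesis
      using that f(2) adj_iff_lev[of u w] assms(2) unfolding candle_E_level level_edges_iff by simp
  qed
  with f(1) h2 n show ?thesis unfolding graph_iso_def by blast
qed

lemma iso_candle1:
  assumes "odd n"
  shows "\<exists>k\<ge>1. n = 2 * k + 1 \<and> graph_iso {0..<n} E (candle1_V k) (candle1_E k)"
proof -
  have top: "card (L height) = 2" using L_height_cases card_levels assms(1) by presburger
  then have n: "n = 2 * height + 1" using card_levels by simp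
  have "card {y \<in> candle1_V height. y div 2 = i} = card (L i)" for i
    unfolding candle1_V_def card_candle1_level using card_L[of i] top height_pos by simp
  then obtain f where f: "bij_betw f {0..<n} (candle1_V height)" "\<And>x. x < n \<Longrightarrow> f x div 2 = lev x"
    using level_bij[of "candle1_V height"] by (auto simp: candle1_V_def)
  have inj: "inj_on f {0..<n}" using f(1) by (simp add: bij_betw_def)
  obtain x y where xy: "L height = {x, y}" "x \<noteq> y" using top by (auto simp: card_2_iff)
  then have x: "x < n" "lev x = height" and y: "y < n" "lev y = height" by (auto simp: L_def)
  have S: "{x, y} \<in> S" using top_pair_adjacent[OF xy] x y SI by simp
  have "f x \<noteq> f y" using inj_onD[OF inj, of x y] xy(2) x y by auto
  moreover have "f x div 2 = height" "f y div 2 = height" using f(2) x y by auto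
  \<comment> \<open>The bijection may place the last two vertices in either order; as an unordered
    edge their image is the same.\<close>
  ultimately have "f x = 2 * height \<and> f y = 2 * height + 1 \<or> f y = 2 * height \<and> f x = 2 * height + 1"
    by presburger
  then have fxy: "{2 * height, 2 * height + 1} = f ` {x, y}" by auto
  have "adj u w \<longleftrightarrow> {f u, f w} \<in> candle1_E height" if uw: "u \<in> {0..<n}" "w \<in> {0..<n}" for u w
  proof -
    have "f u \<in> {1..2 * height + 1}" "f w \<in> {1..2 * height + 1}"
      using bij_betw_apply[OF f(1)] uw unfolding candle1_V_def by blast+
    moreover have "f ` {u, w} = f ` {x, y} \<longleftrightarrow> {u, w} = {x, y}"
      using inj_on_image_eq_iff[OF inj, of "{u, w}" "{x, y}"] uw x y by simp
    moreover have "{u, w} = {x, y} \<longleftrightarrow> {u, w} \<in> S" using S S_unique by metis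
    ultimately show ?thesis
      using uw f(2) adj_iff_lev[of u w]
      unfolding candle1_E_level insert_iff[of "{f u, f w}"] level_edges_iff fxy by (simp, blast)
  qed
  with f(1) height_pos n show ?thesis unfolding graph_iso_def by blast
qed

end

context cubic_rooted_graph
begin

lemma iso_cube: "n = 8" "graph_iso {0..<n} E Q3_V Q3_E"
proof -
  from cube_structure obtain a b c p q r h where
    N: "nbrs v = {a, b, c}" and d: "a \<noteq> b" "a \<noteq> c" "b \<noteq> c"
    and down: "down p = {a, b}" "down q = {a, c}" "down r = {b, c}" "down h = {p, q, r}"
    and L23: "L 2 = {p, q, r}" "L 3 = {h}" and le3: "\<And>x. x < n \<Longrightarrow> lev x \<le> 3"
    and S: "S = {}" and n: "n = 8"
    by blast
  show "n = 8" by (rule n)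
  have L1: "L 1 = {a, b, c}" using N L_1 by simp
  \<comment> \<open>Positions are bit codes: \<open>a\<close>, \<open>b\<close>, \<open>c\<close>
    stand for the single bits 1, 2, 4, and every higher vertex stands at the union of the bits below
    it.\<close>
  let ?xs = "[v, a, b, p, c, q, r, h]"
  have lev: "lev a = 1" "lev b = 1" "lev c = 1" "lev p = 2" "lev q = 2" "lev r = 2" "lev h = 3"
    and less: "a < n" "b < n" "c < n" "p < n" "q < n" "r < n" "h < n"
    using L1 L23 unfolding L_def by blast+
  have "p \<noteq> q" "p \<noteq> r" "q \<noteq> r" using down d by (auto simp: doubleton_eq_iff)
  moreover have "v \<notin> {a, b, c, p, q, r, h}"
  proof
    assume "v \<in> {a, b, c, p, q, r, h}"
    then have "lev v \<noteq> 0" using lev by fastforce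
    then show False by simp
  qed
  moreover have "{a, b, c} \<inter> {p, q, r, h} = {}" "h \<notin> {p, q, r}" using lev by fastforce+
  ultimately have dist: "distinct ?xs" using d by auto
  have all: "x \<in> set ?xs" if x: "x < n" for x
  proof -
    have "lev x = 0 \<or> lev x = 1 \<or> lev x = 2 \<or> lev x = 3" using le3[OF x] by linarith
    then have "x \<in> L 0 \<union> L 1 \<union> L 2 \<union> L 3" using x unfolding L_def by blast
    then show ?thesis unfolding L_0 L1 L23 by auto
  qed
  have set: "set ?xs = {0..<n}"
  proof
    show "set ?xs \<subseteq> {0..<n}" using less v_less by simp
    show "{0..<n} \<subseteq> set ?xs" using all by (meson atLeastLessThan_iff subsetI)
  qed
  have bij: "bij_betw (nth ?xs) Q3_V {0..<n}"
    unfolding Q3_V_def set[symmetric] by (rule bij_betw_nth[OF dist]) auto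
  have img: "(`) (nth ?xs) ` Q3_E = {{v,a}, {v,b}, {v,c}, {a,p}, {a,q}, {b,p}, {b,r}, {c,q}, {c,r}, {p,h}, {q,h}, {r,h}}"
    unfolding Q3_E_eq by simp
  have mem: "a \<in> down p" "b \<in> down p" "a \<in> down q" "c \<in> down q" "b \<in> down r" "c \<in> down r"
    "p \<in> down h" "q \<in> down h" "r \<in> down h"
    using down by auto
  have vadj: "adj v a" "adj v b" "adj v c" using N by (auto simp: nbrs_def)
  have "{x, y} \<in> (`) (nth ?xs) ` Q3_E" if y: "y \<in> down x" for x y
  proof -
    have x: "x \<in> set ?xs" unfolding set using downD(4)[OF y] by simp
    have "down a = {v}" "down b = {v}" "down c = {v}" using lev less down_lev_1 by auto
    with x y down down_v
    have "x \<in> {a, b, c} \<and> y = v \<or> x = p \<and> y \<in> {a, b} \<or> x = q \<and> y \<in> {a, c}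
        \<or> x = r \<and> y \<in> {b, c} \<or> x = h \<and> y \<in> {p, q, r}"
      by fastforce
    then show ?thesis
      unfolding img insert_iff empty_iff by (elim disjE conjE) (simp_all add: insert_commute)
  qed
  note edge = this
  have "E = (`) (nth ?xs) ` Q3_E"
  proof
    show "(`) (nth ?xs) ` Q3_E \<subseteq> E" unfolding img using mem[THEN downD(2)] vadj by simp
    show "E \<subseteq> (`) (nth ?xs) ` Q3_E"
    proof
      fix e assume "e \<in> E"
      then obtain x y where e: "e = {x, y}" "adj x y" using edgeE by blast
      then have "y \<in> down x \<or> x \<in> down y" using adj_cases S by auto
      then show "e \<in> (`) (nth ?xs) ` Q3_E" using edge[of y x] edge[of x y] e(1) by (auto simp: insert_commute)
    qed
  qed
  then have "graph_iso Q3_V Q3_E {0..<n} E" using graph_iso_image[OF bij simple_Q3] by simp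
  then show "graph_iso {0..<n} E Q3_V Q3_E" by (rule graph_iso_sym)
qed

end

context orthogonal_graph
begin

text \<open>An upper bound as hypothesis serves both halves of the theorem: the listed graphs have
  exactly this many edges, so no graph has fewer.\<close>

lemma sparse_cases:
  assumes "card E \<le> (if even n then 2 * n - 4 else 2 * n - 3)"
  shows "(even n \<and> (graph_iso {0..<n} E Q3_V Q3_E \<or>
      (\<exists>k\<ge>2. n = 2 * k \<and> graph_iso {0..<n} E (candle_V k) (candle_E k))))
    \<or> (odd n \<and> (\<exists>k\<ge>1. n = 2 * k + 1 \<and> graph_iso {0..<n} E (candle1_V k) (candle1_E k)))"
proof -
  obtain v where v: "v < n" "\<And>x. x < n \<Longrightarrow> card (nbrs v) \<le> card (nbrs x)"
    using ex_has_least_nat[of "\<lambda>x. x < n" 0 "\<lambda>x. card (nbrs x)"] n_ge_3 by auto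
  interpret rooted_orthogonal_graph n E m v
    by unfold_locales (rule v(1))
  have S_odd: "1 \<le> card S" if "odd n"
  proof -
    have "S \<noteq> {}" using bipartite_even that by blast
    then have "0 < card S" by (simp add: card_gt_0_iff)
    then show ?thesis by linarith
  qed
  have "card (nbrs v) * n \<le> 2 * card E"
    using sum_bounded_below[of "{..<n}" "card (nbrs v)" "\<lambda>x. card (nbrs x)"] v(2) sum_degrees
    by (simp add: mult.commute)
  have "card (nbrs v) < 4"
  proof (rule ccontr)
    assume "\<not> ?thesis"
    then have "4 * n \<le> card (nbrs v) * n" by (intro mult_le_mono1) simp
    then have "2 * n \<le> card E" using \<open>card (nbrs v) * n \<le> 2 * card E\<close> by linarith
    with assms n_ge_3 show False by (simp split: if_splits)
  qed
  then consider "card (nbrs v) = 2" | "card (nbrs v) = 3" using degree_ge_2[OF v(1)] by linarith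
  then show ?thesis
  proof cases
    case 1
    \<comment> \<open>For d = 2 the count is 2n - 4 + s + t; for odd n the one unit goes to
      \<open>S\<close> by \<open>S_odd\<close>, which leaves \<open>excess\<close> zero.\<close>
    have budget: "card S + excess \<le> (if even n then 0 else 1)"
    proof (cases "even n")
      case True
      then have "card E \<le> 2 * n - 4" using assms by simp
      then have "card S + excess \<le> 0" using card_E n_ge_3 1 by linarith
      with True show ?thesis by (simp only: if_True)
    qed (use card_E assms n_ge_3 1 in simp)
    then have ex0: "excess = 0" and S1: "card S \<le> 1" using S_odd by (auto split: if_splits)
    have "card (down x) = 2" if "x < n" "2 \<le> lev x" for x
      using down_card_excess[OF that] card_down_ge_2[OF that] ex0 by simp
    then interpret thin_rooted_graph n E m v
      using 1 S1 by unfold_locales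
    show ?thesis
    proof (cases "even n")
      case True
      then have "S = {}" using budget by simp
      with iso_candle True show ?thesis by blast
    next
      case False with iso_candle1 show ?thesis by blast
    qed
  next
    case 2
    have budget: "card S + excess \<le> (if even n then 1 else 2)"
      using card_E assms n_ge_3 2 by (auto split: if_splits)
    then have ex1: "excess \<le> 1" using S_odd by (auto split: if_splits)
    interpret cubic_rooted_graph n E m v
    proof
      show "3 \<le> card (nbrs x)" if "x < n" for x using v(2)[OF that] 2 by simp
      show "card (down x) = 3" if "x \<in> heavy" for x
        using heavy_card[OF that] down_card_excess[of x] that ex1 unfolding heavy_def by simp
      have "card heavy \<le> 1" using card_heavy_le ex1 by simp
      then show "x = y" if "x \<in> heavy" "y \<in> heavy" for x y
        using that card_le_Suc0_iff_eq[OF finite_heavy] by simp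
      show "card S + card heavy \<le> 2" "odd n \<or> card S + card heavy \<le> 1"
        using budget card_heavy_le by (auto split: if_splits)
    qed (rule 2)
    show ?thesis using iso_cube by simp
  qed
qed

end

theorem mainTheorem1:
  fixes n :: nat and E :: "nat set set"
  assumes "n \<ge> 3"
    and "simple_graph {0..<n} E"
    and "graph_connected {0..<n} E"
    and "q_graph n E = 2"
  shows "card E \<ge> (if even n then 2*n - 4 else 2*n - 3)
    \<and> (even n \<longrightarrow> (card E = 2*n - 4 \<longleftrightarrow>
          graph_iso {0..<n} E Q3_V Q3_E \<or>
          (\<exists>k\<ge>2. n = 2*k \<and> graph_iso {0..<n} E (candle_V k) (candle_E k))))
    \<and> (odd n \<longrightarrow> (card E = 2*n - 3 \<longleftrightarrow>
          (\<exists>k\<ge>1. n = 2*k+1 \<and> graph_iso {0..<n} E (candle1_V k) (candle1_E k))))"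
proof -
  obtain m :: "nat \<Rightarrow> nat \<Rightarrow> real" where
    "\<And>i j. i < n \<Longrightarrow> j < n \<Longrightarrow> m i j = m j i"
    "\<And>i j. i < n \<Longrightarrow> j < n \<Longrightarrow> i \<noteq> j \<Longrightarrow> m i j \<noteq> 0 \<longleftrightarrow> {i, j} \<in> E"
    "\<And>i j. i < n \<Longrightarrow> j < n \<Longrightarrow> (\<Sum>k<n. m i k * m k j) = (if i = j then 1 else 0)"
    using q_graph_two_symmetric_orthogonal[OF assms(4)] by blast
  then interpret orthogonal_graph n E m
    using assms by unfold_locales
  have Q3: "card E = 2 * n - 4" if "graph_iso {0..<n} E Q3_V Q3_E"
  proof -
    have "card {0..<n} = card Q3_V"
      using that bij_betw_same_card unfolding graph_iso_def by blast
    then have "n = 8" by (simp add: Q3_V_def)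
    with graph_iso_card[OF that assms(2) simple_Q3] show ?thesis by (simp add: card_Q3)
  qed
  have candle: "card E = 2 * n - 4"
    if "2 \<le> k" "n = 2 * k" "graph_iso {0..<n} E (candle_V k) (candle_E k)" for k
    using graph_iso_card[OF that(3) assms(2) simple_candle] card_candle[OF that(1)] that(2) by simp
  have candle1: "card E = 2 * n - 3"
    if "1 \<le> k" "n = 2 * k + 1" "graph_iso {0..<n} E (candle1_V k) (candle1_E k)" for k
    using graph_iso_card[OF that(3) assms(2) simple_candle1[OF that(1)]] card_candle1[OF that(1)] that(2)
    by simp
  show ?thesis
  proof (cases "even n")
    case True
    have "graph_iso {0..<n} E Q3_V Q3_E \<or>
        (\<exists>k\<ge>2. n = 2 * k \<and> graph_iso {0..<n} E (candle_V k) (candle_E k))" if "card E \<le> 2 * n - 4"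
      using sparse_cases True that by auto
    note sparse = this
    have "card E = 2 * n - 4" if "card E \<le> 2 * n - 4"
      using sparse[OF that] Q3 candle by blast
    then have "2 * n - 4 \<le> card E" by linarith
    moreover have "card E = 2 * n - 4 \<longleftrightarrow> graph_iso {0..<n} E Q3_V Q3_E \<or>
        (\<exists>k\<ge>2. n = 2 * k \<and> graph_iso {0..<n} E (candle_V k) (candle_E k))"
      using sparse[OF eq_refl] Q3 candle by blast
    ultimately show ?thesis using True by simp
  next
    case False
    have "\<exists>k\<ge>1. n = 2 * k + 1 \<and> graph_iso {0..<n} E (candle1_V k) (candle1_E k)" if "card E \<le> 2 * n - 3"
      using sparse_cases False that by auto
    note sparse = this
    have "card E = 2 * n - 3" if "card E \<le> 2 * n - 3"
      using sparse[OF that] candle1 by blast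
    then have "2 * n - 3 \<le> card E" by linarith
    moreover have "card E = 2 * n - 3 \<longleftrightarrow>
        (\<exists>k\<ge>1. n = 2 * k + 1 \<and> graph_iso {0..<n} E (candle1_V k) (candle1_E k))"
      using sparse[OF eq_refl] candle1 by blast
    ultimately show ?thesis using False by simp
  qed
qed

end
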